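(* Let $d\ge 2$ and let $G=(V,E)$ be a finite $d$-regular bipartite Ramanujan graph. Then there exists a shift $3$-lift of $G$ which is also $d$-regular, bipartite and Ramanujan, and there exists a shift $4$-lift of $G$ which is also $d$-regular, bipartite and Ramanujan.
   Context: A $d$-regular graph is Ramanujan if every eigenvalue $\lambda$ of its adjacency matrix other than the trivial eigenvalues $\pm d$ satisfies $|\lambda|\le 2\sqrt{d-1}$. Identify $V$ with $\{1,\dots,n\}$ and orient each edge $\{u,v\}$ as $(u,v)$ with $u<v$. A shift $k$-lift of $G$ is specified by a shift function $s:E\to\{0,1,\dots,k-1\}$ (with the convention $s(v,u)\equiv -s(u,v)\pmod k$); the lifted graph $H$ has vertex set $\{v^j: v\in V,\ j\in\{0,\dots,k-1\}\}$ and, for each oriented edge $(u,v)\in E$ and each $j$, an edge between $u^j$ and $v^{(j+s(u,v))\bmod k}$. *)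

theory Defs
  imports Complex_Main
    "HOL-Library.Multiset"
    "HOL-Computational_Algebra.Polynomial"
    "Jordan_Normal_Form.Char_Poly"
begin

definition simple_graph :: "'a set \<Rightarrow> 'a set set \<Rightarrow> bool" where
  "simple_graph V E \<longleftrightarrow>
     finite V \<and> (\<forall>e\<in>E. \<exists>u\<in>V. \<exists>v\<in>V. u \<noteq> v \<and> e = {u, v})"

definition regular_graph :: "nat \<Rightarrow> 'a set \<Rightarrow> 'a set set \<Rightarrow> bool" where
  "regular_graph d V E \<longleftrightarrow> (\<forall>v\<in>V. card {u \<in> V. {u, v} \<in> E} = d)"

definition bipartite_graph :: "'a set \<Rightarrow> 'a set set \<Rightarrow> bool" where
  "bipartite_graph V E \<longleftrightarrow>
     (\<exists>X Y. X \<union> Y = V \<and> X \<inter> Y = {} \<and> (\<forall>e\<in>E. \<exists>x\<in>X. \<exists>y\<in>Y. e = {x, y}))"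

definition adj_matrix :: "'a list \<Rightarrow> 'a set set \<Rightarrow> real mat" where
  "adj_matrix vs E = mat (length vs) (length vs) (\<lambda>(i, j). if {vs ! i, vs ! j} \<in> E then 1 else 0)"

text \<open>
  The eigenvalues of the adjacency matrix, with multiplicity. The matrix is real symmetric, so all
  its eigenvalues are real. The enumeration of the vertices is irrelevant: see
  \<open>graph_spectrum_eq\<close> below.
\<close>
definition graph_spectrum :: "'a set \<Rightarrow> 'a set set \<Rightarrow> real multiset" where
  "graph_spectrum V E =
     proots (char_poly (adj_matrix (SOME vs. distinct vs \<and> set vs = V) E))"

text \<open>
  The trivial eigenvalues \<open>d\<close> and \<open>-d\<close> are discarded once each (\<open>-d\<close> only if it
  occurs); further copies of \<open>d\<close> or \<open>-d\<close> are nontrivial eigenvalues and must obey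
  the bound. If all copies of \<open>d\<close> and \<open>-d\<close> were exempt, \<open>k\<close> disjoint copies of a Ramanujan
  graph, i.e. its \<open>k\<close>-lift with all shifts zero, would again be Ramanujan.
\<close>
definition ramanujan_graph :: "nat \<Rightarrow> 'a set \<Rightarrow> 'a set set \<Rightarrow> bool" where
  "ramanujan_graph d V E \<longleftrightarrow>
     (\<forall>\<mu> \<in># graph_spectrum V E - {# real d, - real d #}. \<bar>\<mu>\<bar> \<le> 2 * sqrt (real d - 1))"

text \<open>In the following, \<open>num\<close> is the identification of the vertex set with \<open>{1..n}\<close>.\<close>

definition oriented_edges :: "('a \<Rightarrow> nat) \<Rightarrow> 'a set set \<Rightarrow> ('a \<times> 'a) set" where
  "oriented_edges num E = {(u, v). {u, v} \<in> E \<and> num u < num v}"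

definition shift_function :: "('a \<Rightarrow> nat) \<Rightarrow> nat \<Rightarrow> 'a set set \<Rightarrow> ('a \<times> 'a \<Rightarrow> nat) \<Rightarrow> bool" where
  "shift_function num k E s \<longleftrightarrow> (\<forall>e \<in> oriented_edges num E. s e \<in> {0..<k})"

definition lift_verts :: "nat \<Rightarrow> 'a set \<Rightarrow> ('a \<times> nat) set" where
  "lift_verts k V = V \<times> {0..<k}"

definition lift_edges ::
    "('a \<Rightarrow> nat) \<Rightarrow> nat \<Rightarrow> 'a set set \<Rightarrow> ('a \<times> 'a \<Rightarrow> nat) \<Rightarrow> ('a \<times> nat) set set" where
  "lift_edges num k E s =
     {{(u, j), (v, (j + s (u, v)) mod k)} | u v j. (u, v) \<in> oriented_edges num E \<and> j \<in> {0..<k}}"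

lemma char_poly_adj_matrix_cong:
  assumes "distinct vs" "distinct ws" "set vs = set ws"
  shows "char_poly (adj_matrix vs E) = char_poly (adj_matrix ws E)"
proof -
  define n where "n = length vs"
  have n: "length ws = n" "length vs = n"
    using assms distinct_card[of vs] distinct_card[of ws] by (auto simp: n_def)
  have ex: "\<exists>k<n. ws ! k = vs ! i" if "i < n" for i
    using that assms(3) n by (metis in_set_conv_nth nth_mem)
  define f where "f i = (SOME k. k < n \<and> ws ! k = vs ! i)" for i
  have f: "f i < n" "ws ! f i = vs ! i" if "i < n" for i
    using someI_ex[OF ex[OF that]] unfolding f_def by auto
  have inj: "inj_on f {0..<n}"
    by (rule inj_onI) (metis assms(1) atLeastLessThan_iff f(2) n(2) nth_eq_iff_index_eq)
  define P :: "real mat" where "P = mat n n (\<lambda>(i, j). if f i = j then 1 else 0)"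
  define Q :: "real mat" where "Q = mat n n (\<lambda>(i, j). if f j = i then 1 else 0)"
  have PQ: "P * Q = 1\<^sub>m n"
  proof (rule eq_matI)
    fix i j assume "i < dim_row (1\<^sub>m n :: real mat)" "j < dim_col (1\<^sub>m n :: real mat)"
    then have ij: "i < n" "j < n" by auto
    have "(P * Q) $$ (i, j) = (\<Sum>k\<in>{0..<n}. P $$ (i, k) * Q $$ (k, j))"
      using ij by (simp add: P_def Q_def scalar_prod_def)
    also have "\<dots> = (\<Sum>k\<in>{0..<n}. if f i = k then (if f j = k then 1 else 0) else 0)"
      using ij by (intro sum.cong) (auto simp: P_def Q_def)
    also have "\<dots> = (if f j = f i then 1 else 0)"
      using f(1)[OF ij(1)] by (subst sum.delta') auto
    also have "\<dots> = 1\<^sub>m n $$ (i, j)"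
      using ij inj_on_eq_iff[OF inj, of j i] by auto
    finally show "(P * Q) $$ (i, j) = 1\<^sub>m n $$ (i, j)" .
  qed (auto simp: P_def Q_def)
  have P: "P \<in> carrier_mat n n" and Q: "Q \<in> carrier_mat n n" by (auto simp: P_def Q_def)
  have QP: "Q * P = 1\<^sub>m n"
    using mat_mult_left_right_inverse[OF P Q PQ] .
  have B: "adj_matrix ws E \<in> carrier_mat n n" "adj_matrix vs E \<in> carrier_mat n n"
    by (auto simp: adj_matrix_def n)
  have entry: "(M * N) $$ (i, j) = (\<Sum>k\<in>{0..<n}. M $$ (i, k) * N $$ (k, j))"
    if "M \<in> carrier_mat n n" "N \<in> carrier_mat n n" "i < n" "j < n" for M N :: "real mat" and i j
    using that by (simp add: scalar_prod_def)
  have PB: "(P * adj_matrix ws E) $$ (i, j) = adj_matrix ws E $$ (f i, j)" if "i < n" "j < n" for i j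
  proof -
    have "(P * adj_matrix ws E) $$ (i, j) = (\<Sum>k\<in>{0..<n}. P $$ (i, k) * adj_matrix ws E $$ (k, j))"
      using that B P by (simp add: scalar_prod_def)
    also have "\<dots> = (\<Sum>k\<in>{0..<n}. if f i = k then adj_matrix ws E $$ (k, j) else 0)"
      using that by (intro sum.cong) (auto simp: P_def)
    also have "\<dots> = adj_matrix ws E $$ (f i, j)" using f(1)[OF that(1)] by (subst sum.delta') auto
    finally show ?thesis .
  qed
  have "adj_matrix vs E = P * adj_matrix ws E * Q"
  proof (rule eq_matI)
    fix i j assume "i < dim_row (P * adj_matrix ws E * Q)" "j < dim_col (P * adj_matrix ws E * Q)"
    then have ij: "i < n" "j < n" by (auto simp: P_def Q_def)
    have "(P * adj_matrix ws E * Q) $$ (i, j)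
        = (\<Sum>k\<in>{0..<n}. (P * adj_matrix ws E) $$ (i, k) * Q $$ (k, j))"
      using entry[OF mult_carrier_mat[OF P B(1)] Q ij] .
    also have "\<dots> = (\<Sum>k\<in>{0..<n}. if f j = k then (P * adj_matrix ws E) $$ (i, k) else 0)"
      using ij by (intro sum.cong) (auto simp: Q_def)
    also have "\<dots> = (P * adj_matrix ws E) $$ (i, f j)"
      using f(1)[OF ij(2)] by (subst sum.delta') auto
    also have "\<dots> = adj_matrix ws E $$ (f i, f j)" using PB ij f by simp
    also have "\<dots> = adj_matrix vs E $$ (i, j)" using ij f by (simp add: adj_matrix_def n)
    finally show "adj_matrix vs E $$ (i, j) = (P * adj_matrix ws E * Q) $$ (i, j)" by simp
  qed (auto simp: P_def Q_def adj_matrix_def n)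
  then have "similar_mat (adj_matrix vs E) (adj_matrix ws E)"
    using B P Q PQ QP by (intro similar_matI[where P = P and Q = Q and n = n]) auto
  then show ?thesis by (rule char_poly_similar)
qed

lemma graph_spectrum_eq:
  assumes "distinct vs" "set vs = V"
  shows "graph_spectrum V E = proots (char_poly (adj_matrix vs E))"
proof -
  let ?ws = "SOME ws. distinct ws \<and> set ws = V"
  have "distinct ?ws \<and> set ?ws = V" by (rule someI[of _ vs]) (use assms in simp)
  then show ?thesis
    using char_poly_adj_matrix_cong[of ?ws vs E] assms by (simp add: graph_spectrum_def)
qed

lemma in_graph_spectrum_iff:
  assumes "distinct vs" "set vs = V"
  shows "\<mu> \<in># graph_spectrum V E \<longleftrightarrow> eigenvalue (adj_matrix vs E) \<mu>"
proof -
  have A: "adj_matrix vs E \<in> carrier_mat (length vs) (length vs)" by (simp add: adj_matrix_def)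
  have "char_poly (adj_matrix vs E) \<noteq> 0"
    using degree_monic_char_poly[OF A] by auto
  then show ?thesis
    by (simp add: graph_spectrum_eq[OF assms] eigenvalue_root_char_poly[OF A])
qed

end

theory Submission
  imports Defs
begin

text \<open>
  The new eigenvalues of a shift lift are those of the Hermitian matrices obtained from the adjacency
  matrix by replacing each entry by a character value of its shift. Following Marcus, Spielman and
  Srivastava, average the characteristic polynomial of \<open>d I + A\<close> over random edge weights of mean
  zero: the result is the (shifted) matching polynomial, which is positive to the right of
  \<open>2 sqrt (d - 1)\<close>.

  The weights are then fixed edge by edge. The determinant is affine along a rank-one direction, and
  the averages \<open>g + t D\<close> do not vanish when the matrix has positive definite imaginary part and
  \<open>Im t \<ge> 0\<close>. So \<open>D / g\<close> maps the upper half-plane to the lower one, hence is decreasing on the real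
  line, and some choice of the weight keeps the polynomial positive to the right of the bound.
  Bipartiteness makes the spectrum symmetric, which gives the lower bound.

  For \<open>k = 3\<close> the two nontrivial characters are conjugate. For \<open>k = 4\<close> first choose the shifts
  modulo 2, taking care of the character of order 2, and then their upper bits.
\<close>

section \<open>Real polynomials with nonpositive Wronskian\<close>

text \<open>A bound on the roots of an average in general says nothing about the polynomials
  averaged. Adding \<open>d I\<close> repairs this: the weighted adjacency matrix becomes a sum of
  Hermitian rank-one matrices, one per edge, and choosing a weight fixes a single summand. The
  determinant is affine along it, so the candidates for one edge have the form
  \<open>g - D m\<close> with a common \<open>g\<close>, and the sign of the Wronskian of
  \<open>D m\<close> and \<open>g\<close> takes the place of a common interlacing. The invariant
  carried from edge to edge is positivity to the right of the bound, rather than real-rootedness.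

  The restriction on \<open>k\<close> comes from the fact that one run of choices controls one
  polynomial, hence one pair of conjugate characters. For \<open>k = 5\<close> two such pairs would
  depend on the same choices.\<close>

lemma poly_map_Re: "poly (map_poly Re p) x = Re (poly p (of_real x))"
  by (induction p) (auto simp: map_poly_pCons)

lemma pderiv_map_Re: "pderiv (map_poly Re p) = map_poly Re (pderiv p)"
  by (rule poly_eqI) (simp add: coeff_pderiv coeff_map_poly)

text \<open>On the way from \<open>x\<close> straight up into the upper half-plane, the imaginary
  part of \<open>q * cnj p\<close> starts at 0 and stays nonpositive, so its initial derivative is
  nonpositive. As \<open>p\<close> and \<open>q\<close> are real on the real line, this derivative
  is the Wronskian.\<close>

lemma wronskian_nonpos:
  fixes p q :: "complex poly" and x :: real
  assumes neg: "\<And>z. Im z > 0 \<Longrightarrow> Im (poly q z * cnj (poly p z)) \<le> 0"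
    and re: "\<And>x::real. Im (poly p (of_real x)) = 0" "\<And>x::real. Im (poly q (of_real x)) = 0"
  shows "poly (pderiv (map_poly Re q)) x * poly (map_poly Re p) x
       - poly (map_poly Re q) x * poly (pderiv (map_poly Re p)) x \<le> 0"
proof -
  define z where "z t = complex_of_real x + \<i> * of_real t" for t
  define f where "f t = Im (poly q (z t) * cnj (poly p (z t)))" for t
  define L where "L = poly (pderiv (map_poly Re q)) x * poly (map_poly Re p) x
       - poly (map_poly Re q) x * poly (pderiv (map_poly Re p)) x"
  have z': "(z has_vector_derivative \<i>) (at 0)"
    unfolding z_def by (auto intro!: derivative_eq_intros simp: has_vector_derivative_def scaleR_conv_of_real)
  have pz: "((\<lambda>t. poly r (z t)) has_vector_derivative \<i> * poly (pderiv r) (of_real x)) (at 0)" for r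
    using has_derivative_compose[OF z'[unfolded has_vector_derivative_def]
        poly_DERIV[of r "z 0", unfolded has_field_derivative_def]]
    by (simp add: has_vector_derivative_def z_def mult_ac)
  have "((\<lambda>t. poly q (z t) * cnj (poly p (z t))) has_vector_derivative
      poly q (z 0) * cnj (\<i> * poly (pderiv p) (of_real x)) + \<i> * poly (pderiv q) (of_real x) * cnj (poly p (z 0))) (at 0)"
    by (intro has_vector_derivative_mult pz bounded_linear.has_vector_derivative[OF bounded_linear_cnj])
  then have "(f has_vector_derivative Im (poly q (z 0) * cnj (\<i> * poly (pderiv p) (of_real x))
      + \<i> * poly (pderiv q) (of_real x) * cnj (poly p (z 0)))) (at 0)"
    unfolding f_def by (rule bounded_linear.has_vector_derivative[OF bounded_linear_Im])
  also have "Im (poly q (z 0) * cnj (\<i> * poly (pderiv p) (of_real x))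
      + \<i> * poly (pderiv q) (of_real x) * cnj (poly p (z 0))) = L"
    using re[of x] by (simp add: L_def z_def poly_map_Re pderiv_map_Re)
  finally have der: "(f has_real_derivative L) (at 0)"
    by (simp add: has_real_derivative_iff_has_vector_derivative)
  have f0: "f 0 = 0" using re[of x] by (simp add: f_def z_def)
  have fneg: "f t \<le> 0" if "t > 0" for t using neg[of "z t"] that by (simp add: f_def z_def)
  show ?thesis
  proof (rule ccontr)
    assume "\<not> ?thesis"
    then have "L > 0" by (simp add: L_def)
    from DERIV_pos_inc_right[OF der this] f0 obtain d where "d > 0" "\<forall>h>0. h < d \<longrightarrow> 0 < f h" by auto
    then have "0 < f (d/2)" by simp
    with fneg[of "d/2"] \<open>d > 0\<close> show False by simp
  qed
qed

lemma ratio_antimono: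
  fixes g q :: "real poly"
  assumes wr: "\<And>x. poly (pderiv q) x * poly g x - poly q x * poly (pderiv g) x \<le> 0"
    and pos: "\<And>x. x > c \<Longrightarrow> poly g x > 0" and "c < x" "x \<le> y"
  shows "poly q y / poly g y \<le> poly q x / poly g x"
proof (cases "x = y")
  case False
  have "\<exists>D. ((\<lambda>x. poly q x / poly g x) has_real_derivative D) (at t) \<and> D \<le> 0" if "x \<le> t" for t
  proof -
    have "poly g t > 0" using pos[of t] that assms by auto
    then have "((\<lambda>x. poly q x / poly g x) has_real_derivative
       (poly (pderiv q) t * poly g t - poly q t * poly (pderiv g) t) / (poly g t * poly g t)) (at t)"
      by (intro DERIV_divide poly_DERIV) auto
    then show ?thesis using wr[of t] by (meson divide_nonpos_nonneg zero_le_square)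
  qed
  then show ?thesis using DERIV_nonpos_imp_nonincreasing[of x y "\<lambda>x. poly q x / poly g x"] assms by blast
qed simp

text \<open>The degrees make the quotient tend to 0 at infinity; as it is decreasing to the right of
  \<open>c\<close>, it lies above its limit.\<close>

lemma ratio_nonneg:
  fixes g q :: "real poly"
  assumes wr: "\<And>x. poly (pderiv q) x * poly g x - poly q x * poly (pderiv g) x \<le> 0"
    and pos: "\<And>x. x > c \<Longrightarrow> poly g x > 0" and deg: "q = 0 \<or> degree q < degree g" and "c < x"
  shows "0 \<le> poly q x"
proof (cases "q = 0")
  case False
  then have "((\<lambda>x. poly q x / poly g x) \<longlongrightarrow> 0) at_infinity"
    using deg by (intro poly_divide_tendsto_0_at_infinity) auto
  then have lim: "((\<lambda>x. poly q x / poly g x) \<longlongrightarrow> 0) at_top"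
    using at_top_le_at_infinity tendsto_mono by blast
  have ev: "eventually (\<lambda>y. poly q y / poly g y \<le> poly q x / poly g x) at_top"
    using eventually_ge_at_top[of x] by eventually_elim (rule ratio_antimono[OF wr pos \<open>c < x\<close>])
  have "0 \<le> poly q x / poly g x"
    by (rule tendsto_upperbound[OF lim ev]) simp
  then show ?thesis using pos[OF \<open>c < x\<close>] by (simp add: zero_le_divide_iff)
qed simp

text \<open>
  The Wronskian condition makes every \<open>D i / g\<close> decrease to 0 to the right of the largest root of
  \<open>g\<close>, so there each \<open>g - D i\<close> changes sign at most once, from negative to positive.
\<close>

lemma interlacing_selection:
  fixes g :: "real poly" and D :: "'i \<Rightarrow> real poly" and lam :: real
  assumes I: "finite I" "I \<noteq> {}" and lc: "lead_coeff g > 0"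
    and deg: "\<And>i. i \<in> I \<Longrightarrow> D i = 0 \<or> degree (D i) < degree g"
    and wr: "\<And>i x. i \<in> I \<Longrightarrow> poly (pderiv (D i)) x * poly g x - poly (D i) x * poly (pderiv g) x \<le> 0"
    and avg: "\<And>x. x > lam \<Longrightarrow> 0 < (\<Sum>i\<in>I. poly (g - D i) x)"
  shows "\<exists>i\<in>I. \<forall>x>lam. 0 < poly (g - D i) x"
proof -
  have g0: "g \<noteq> 0" using lc by auto
  \<comment> \<open>Otherwise \<open>g\<close> has a largest root \<open>r\<close>, and it lies to
    the right of \<open>lam\<close>. Beyond \<open>r\<close> every \<open>D i\<close> is
    nonnegative, by continuity also at \<open>r\<close>; there all \<open>g - D i\<close> are
    nonpositive, against \<open>avg\<close>.\<close>
  have gpos: "poly g x > 0" if "x > lam" for x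
  proof (rule ccontr)
    assume neg: "\<not> poly g x > 0"
    obtain N where N: "\<And>y. y \<ge> N \<Longrightarrow> poly g y \<ge> lead_coeff g" using poly_pinfty_gt_lc[OF lc] by blast
    define R where "R = {y. poly g y = 0}"
    have fR: "finite R" unfolding R_def using g0 by (rule poly_roots_finite)
    have "\<exists>y\<ge>x. y \<le> max N x \<and> poly g y = 0"
      using N[of "max N x"] neg lc by (intro IVT') (auto intro!: continuous_intros)
    then obtain y where y: "y \<ge> x" "y \<in> R" by (auto simp: R_def)
    define r where "r = Max R"
    have r: "r \<in> R" "r > lam" using Max_in[OF fR] Max_ge[OF fR y(2)] y that unfolding r_def by (blast, linarith)
    have pos: "poly g t > 0" if "t > r" for t
    proof (rule ccontr)
      assume "\<not> poly g t > 0"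
      then have "\<exists>y\<ge>t. y \<le> max N t \<and> poly g y = 0"
        using N[of "max N t"] lc by (intro IVT') (auto intro!: continuous_intros)
      then obtain y where "y \<ge> t" "y \<in> R" by (auto simp: R_def)
      then show False using Max_ge[OF fR, of y] that by (auto simp: r_def)
    qed
    have "0 \<le> poly (D i) r" if i: "i \<in> I" for i
    proof (rule tendsto_lowerbound)
      show "((\<lambda>t. poly (D i) t) \<longlongrightarrow> poly (D i) r) (at_right r)" by (intro tendsto_intros)
      show "eventually (\<lambda>t. 0 \<le> poly (D i) t) (at_right r)"
        using eventually_at_right_less[of r]
        by eventually_elim (rule ratio_nonneg[OF wr[OF i] pos deg[OF i]])
    qed simp
    then have "(\<Sum>i\<in>I. poly (g - D i) r) \<le> 0" using r by (intro sum_nonpos) (auto simp: R_def)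
    with avg[OF r(2)] show False by simp
  qed
  show ?thesis
  proof (rule ccontr)
    assume "\<not> ?thesis"
    then have "\<forall>i\<in>I. \<exists>x>lam. poly (g - D i) x \<le> 0" by (auto simp: not_less)
    then obtain X where X: "\<And>i. i \<in> I \<Longrightarrow> X i > lam \<and> poly (g - D i) (X i) \<le> 0" by metis
    \<comment> \<open>If every candidate fails somewhere, all of them fail at the leftmost of these
      points: \<open>D i / g\<close> is at least 1 at \<open>X i\<close> and can only be larger
      further left.\<close>
    define m where "m = Min (X ` I)"
    have m: "m > lam" using I X by (simp add: m_def)
    have "poly (g - D i) m \<le> 0" if i: "i \<in> I" for i
    proof -
      have "m \<le> X i" using I i by (simp add: m_def)
      then have "poly (D i) (X i) / poly g (X i) \<le> poly (D i) m / poly g m"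
        using ratio_antimono[of "D i" g lam m "X i"] wr[OF i] gpos m by blast
      moreover have "1 \<le> poly (D i) (X i) / poly g (X i)"
        using X[OF i] gpos[of "X i"] by (simp add: le_divide_eq)
      ultimately have "1 \<le> poly (D i) m / poly g m" by linarith
      then show ?thesis using gpos[OF m] by (simp add: le_divide_eq)
    qed
    then have "(\<Sum>i\<in>I. poly (g - D i) m) \<le> 0" by (rule sum_nonpos)
    with avg[OF m] show False by simp
  qed
qed

section \<open>Averages over rank-one edge perturbations\<close>

lemma norm_root_of_unity:
  fixes z :: complex
  assumes "k > 0" "z ^ k = 1" shows "cmod z = 1"
  using assms by (metis norm_one norm_power norm_ge_zero power_eq_1_iff gr_implies_not0)

lemma mult_cnj_unit: "cmod z = 1 \<Longrightarrow> z * cnj z = 1"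
  by (simp add: complex_norm_square[symmetric])

lemma power_mod_root:
  fixes z :: complex
  assumes "z ^ k = 1" shows "z ^ (m mod k) = z ^ m"
proof -
  have "z ^ m = z ^ (m mod k + k * (m div k))" by simp
  also have "\<dots> = z ^ (m mod k)" by (simp only: power_add power_mult assms) simp
  finally show ?thesis by simp
qed

text \<open>Matrices are functions on all of \<open>nat\<close>, so that perturbations, averages and
  entrywise twists need no dimension conditions; the determinant looks only at indices below
  \<open>n\<close>.\<close>

definition mdet :: "nat \<Rightarrow> (nat \<Rightarrow> nat \<Rightarrow> complex) \<Rightarrow> complex" where
  "mdet n M = det (mat n n (\<lambda>(a, b). M a b))"

text \<open>
  The Hermitian rank-one matrix \<open>x x\<^sup>*\<close> with \<open>x = e\<^sub>u + \<open>cnj\<close> w e\<^sub>v\<close>, provided \<open>|w| = 1\<close>. In a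
  \<open>d\<close>-regular graph these matrices add up to \<open>d I + A\<close>, where \<open>A\<close> is the adjacency matrix
  weighted by the \<open>w\<close>'s.
\<close>

definition edge_mat :: "nat \<Rightarrow> nat \<Rightarrow> complex \<Rightarrow> nat \<Rightarrow> nat \<Rightarrow> complex" where
  "edge_mat u v w a b =
     (if a = u \<and> b = u \<or> a = v \<and> b = v then 1
      else if a = u \<and> b = v then w else if a = v \<and> b = u then cnj w else 0)"

definition scal_mat :: "complex \<Rightarrow> nat \<Rightarrow> nat \<Rightarrow> complex" where
  "scal_mat z a b = (if a = b then z else 0)"

definition hermitian :: "(nat \<Rightarrow> nat \<Rightarrow> complex) \<Rightarrow> bool" where
  "hermitian M \<longleftrightarrow> (\<forall>a b. cnj (M a b) = M b a)"

definition qform :: "nat \<Rightarrow> (nat \<Rightarrow> nat \<Rightarrow> complex) \<Rightarrow> (nat \<Rightarrow> complex) \<Rightarrow> complex" where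
  "qform n M x = (\<Sum>i<n. \<Sum>j<n. cnj (x i) * M i j * x j)"

definition posim :: "nat \<Rightarrow> (nat \<Rightarrow> nat \<Rightarrow> complex) \<Rightarrow> bool" where
  "posim n M \<longleftrightarrow> (\<forall>x. (\<exists>i<n. x i \<noteq> 0) \<longrightarrow> Im (qform n M x) > 0)"

text \<open>The expectation of \<open>\<phi>\<close> at \<open>M\<close> minus one random edge
  matrix per list entry, with independent uniform choices. Recursion on a list allows the choices to
  be revealed one by one. The functional is a parameter because the average is taken of the
  determinant and also of its single permutation terms.\<close>

fun edge_avg :: "nat \<Rightarrow> (nat \<times> nat \<Rightarrow> nat \<Rightarrow> complex) \<Rightarrow> (nat \<times> nat) list
    \<Rightarrow> ((nat \<Rightarrow> nat \<Rightarrow> complex) \<Rightarrow> complex) \<Rightarrow> (nat \<Rightarrow> nat \<Rightarrow> complex) \<Rightarrow> complex" where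
  "edge_avg k w [] \<phi> M = \<phi> M"
| "edge_avg k w (e # es) \<phi> M =
     (\<Sum>m<k. edge_avg k w es \<phi> (\<lambda>a b. M a b - edge_mat (fst e) (snd e) (w e m) a b)) / of_nat k"

lemma mdet_perm: "mdet n M = (\<Sum>p | p permutes {..<n}. of_int (sign p) * (\<Prod>i<n. M i (p i)))"
proof -
  have "mdet n M = (\<Sum>p | p permutes {0..<n}. signof p * (\<Prod>i = 0..<n. mat n n (\<lambda>(a, b). M a b) $$ (i, p i)))"
    unfolding mdet_def by (rule det_def') auto
  also have "\<dots> = (\<Sum>p | p permutes {..<n}. of_int (sign p) * (\<Prod>i<n. M i (p i)))"
    unfolding lessThan_atLeast0[symmetric]
  proof (rule sum.cong[OF refl])
    fix p assume "p \<in> {p. p permutes {..<n}}"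
    then have "p i < n" if "i < n" for i using that permutes_in_image[of p "{..<n}" i] by auto
    then show "signof p * (\<Prod>i<n. mat n n (\<lambda>(a, b). M a b) $$ (i, p i)) = of_int (sign p) * (\<Prod>i<n. M i (p i))"
      by (auto intro!: prod.cong)
  qed
  finally show ?thesis .
qed

lemma mdet_cong: "(\<And>a b. a < n \<Longrightarrow> b < n \<Longrightarrow> M a b = N a b) \<Longrightarrow> mdet n M = mdet n N"
  unfolding mdet_def by (rule arg_cong[where f = det]) (auto intro!: eq_matI)

lemma mdet_cnj: "mdet n (\<lambda>a b. cnj (M a b)) = cnj (mdet n M)"
  by (simp add: mdet_perm)

lemma mdet_hermitian_real:
  assumes "hermitian M" shows "Im (mdet n M) = 0"
proof -
  have "cnj (mdet n M) = mdet n (\<lambda>a b. cnj (M a b))"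
    by (simp add: mdet_cnj)
  also have "\<dots> = det (transpose_mat (mat n n (\<lambda>(a, b). M a b)))"
    using assms unfolding mdet_def hermitian_def by (intro arg_cong[where f = det] eq_matI) auto
  also have "\<dots> = mdet n M" unfolding mdet_def by (rule det_transpose) auto
  finally show ?thesis by (metis complex_cnj_cancel_iff complex_eq_iff cnj.sel(2) neg_equal_zero)
qed

lemma mdet_row_affine:
  assumes "u < n"
  shows "mdet n (\<lambda>a b. if a = u then f b + t * g b else M a b)
       = (1 - t) * mdet n (\<lambda>a b. if a = u then f b else M a b) + t * mdet n (\<lambda>a b. if a = u then f b + g b else M a b)"
proof -
  have *: "(\<Prod>i<n. if i = u then h (p i) else M i (p i)) = h (p u) * (\<Prod>i\<in>{..<n}-{u}. M i (p i))" for h p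
    using assms by (subst prod.remove[of _ u]) (auto intro!: prod.cong)
  show ?thesis unfolding mdet_perm *[of f] *[of "\<lambda>b. f b + t * g b"] *[of "\<lambda>b. f b + g b"]
    by (simp add: sum_distrib_left sum.distrib[symmetric] algebra_simps)
qed

text \<open>Subtracting a multiple of row \<open>u\<close> from row \<open>v\<close> confines a rank-one perturbation to row \<open>u\<close>.\<close>

lemma mdet_edge_mat_affine:
  assumes uv: "u < n" "v < n" "u \<noteq> v" and w: "cmod w = 1"
  shows "mdet n (\<lambda>a b. M a b + t * edge_mat u v w a b)
       = (1 - t) * mdet n M + t * mdet n (\<lambda>a b. M a b + edge_mat u v w a b)"
proof -
  have ww: "cnj w * w = 1" using mult_cnj_unit[OF w] by (simp add: mult.commute)
  define R where "R a b = (if a = v then M v b - cnj w * M u b else M a b)" for a b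
  have *: "mdet n (\<lambda>a b. M a b + s * edge_mat u v w a b) =
     mdet n (\<lambda>a b. if a = u then M u b + s * edge_mat u v w u b else R a b)" for s
  proof -
    let ?A = "mat n n (\<lambda>(a, b). M a b + s * edge_mat u v w a b)"
    have "det ?A = det (addrow (- cnj w) v u ?A)"
      by (rule det_addrow[symmetric]) (use uv in auto)
    also have "addrow (- cnj w) v u ?A = mat n n (\<lambda>(a, b). if a = u then M u b + s * edge_mat u v w u b else R a b)"
    proof (rule eq_matI, goal_cases)
      case (1 i j)
      have "edge_mat u v w v j = cnj w * edge_mat u v w u j"
        using ww uv by (auto simp: edge_mat_def)
      moreover have "edge_mat u v w i j = 0" if "i \<noteq> u" "i \<noteq> v" using that by (simp add: edge_mat_def)
      ultimately show ?case using 1 uv by (auto simp: R_def algebra_simps)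
    qed auto
    finally show ?thesis by (simp add: mdet_def)
  qed
  from *[of 0] have 0: "mdet n M = mdet n (\<lambda>a b. if a = u then M u b else R a b)"
    by (simp cong: if_cong)
  show ?thesis using *[of t] *[of 1] mdet_row_affine[OF uv(1), of "M u" t "edge_mat u v w u" R] 0
    by (simp cong: if_cong)
qed

lemma edge_avg_affine:
  assumes "\<And>M. \<phi> (\<lambda>a b. M a b + t * R a b) = (1 - t) * \<phi> M + t * \<phi> (\<lambda>a b. M a b + R a b)"
  shows "edge_avg k w es \<phi> (\<lambda>a b. M a b + t * R a b)
       = (1 - t) * edge_avg k w es \<phi> M + t * edge_avg k w es \<phi> (\<lambda>a b. M a b + R a b)"
proof (induction es arbitrary: M)
  case (Cons e es)
  have *: "M a b + c * R a b - X a b = (M a b - X a b) + c * R a b" for a b c and X :: "nat \<Rightarrow> nat \<Rightarrow> complex"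
    by simp
  have **: "M a b + R a b - X a b = (M a b - X a b) + R a b" for a b and X :: "nat \<Rightarrow> nat \<Rightarrow> complex"
    by simp
  show ?case unfolding edge_avg.simps * ** Cons.IH
    by (simp add: sum.distrib sum_distrib_left[symmetric] add_divide_distrib)
qed (use assms in simp)

text \<open>A kernel vector would make the quadratic form vanish, against its positive imaginary
  part.\<close>

lemma mdet_nonzero:
  assumes "posim n M" shows "mdet n M \<noteq> 0"
proof
  let ?A = "mat n n (\<lambda>(a, b). M a b)"
  assume "mdet n M = 0"
  then obtain v where v: "v \<in> carrier_vec n" "v \<noteq> 0\<^sub>v n" "?A *\<^sub>v v = 0\<^sub>v n"
    using det_0_iff_vec_prod_zero[of ?A n] by (auto simp: mdet_def)
  have "\<exists>i<n. v $ i \<noteq> 0"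
  proof (rule ccontr)
    assume "\<not> ?thesis"
    then have "v = 0\<^sub>v n" using v(1) by (intro eq_vecI) auto
    with v show False by simp
  qed
  then have "Im (qform n M (\<lambda>i. v $ i)) > 0" using assms by (auto simp: posim_def)
  moreover have "(\<Sum>j<n. M i j * v $ j) = 0" if "i < n" for i
  proof -
    have "(?A *\<^sub>v v) $ i = 0" using v(3) that by simp
    then show ?thesis using that v(1) by (simp add: scalar_prod_def lessThan_atLeast0)
  qed
  then have "qform n M (\<lambda>i. v $ i) = 0"
    by (simp add: qform_def mult.assoc sum_distrib_left[symmetric])
  ultimately show False by simp
qed

lemma qform_add: "qform n (\<lambda>a b. M a b + t * N a b) x = qform n M x + t * qform n N x"
proof -
  have "a * (m + t * l) * b = a * m * b + t * (a * l * b)" for a b m l :: complex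
    by (simp add: algebra_simps)
  then show ?thesis by (simp add: qform_def sum.distrib sum_distrib_left)
qed

lemma qform_edge_mat:
  assumes uv: "u < n" "v < n" "u \<noteq> v" and w: "cmod w = 1"
  shows "qform n (edge_mat u v w) x = of_real ((cmod (x u + w * x v))\<^sup>2)"
proof -
  have ww: "cnj w * w = 1" using mult_cnj_unit[OF w] by (simp add: mult.commute)
  have row: "(\<Sum>j<n. cnj (x i) * edge_mat u v w i j * x j) =
     (if i = u then cnj (x u) * (x u + w * x v) else 0) + (if i = v then cnj (x v) * (cnj w * x u + x v) else 0)" for i
  proof -
    have *: "cnj (x i) * edge_mat u v w i j * x j =
      (if j = u then cnj (x i) * edge_mat u v w i u * x u else 0) + (if j = v then cnj (x i) * edge_mat u v w i v * x v else 0)" for j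
      using uv by (auto simp: edge_mat_def)
    have "(\<Sum>j<n. cnj (x i) * edge_mat u v w i j * x j) = cnj (x i) * edge_mat u v w i u * x u + cnj (x i) * edge_mat u v w i v * x v"
      by (subst *) (use uv in \<open>simp add: sum.distrib\<close>)
    then show ?thesis using uv by (auto simp: edge_mat_def algebra_simps)
  qed
  have "qform n (edge_mat u v w) x = cnj (x u) * (x u + w * x v) + cnj (x v) * (cnj w * x u + x v)"
    using uv by (simp add: qform_def row sum.distrib)
  also have "cnj w * x u + x v = cnj w * (x u + w * x v)"
    using ww by (metis distrib_left mult.assoc mult_1)
  also have "cnj (x u) * (x u + w * x v) + cnj (x v) * (cnj w * (x u + w * x v)) = (x u + w * x v) * cnj (x u + w * x v)"
    by (simp add: algebra_simps)
  finally show ?thesis by (simp only: complex_norm_square)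
qed

lemma posim_add_edge_mat:
  assumes "u < n" "v < n" "u \<noteq> v" "cmod w = 1" "posim n M" "Im t \<ge> 0"
  shows "posim n (\<lambda>a b. M a b + t * edge_mat u v w a b)"
  using assms by (auto simp: posim_def qform_add qform_edge_mat intro!: add_pos_nonneg)

lemma hermitian_edge_mat: "u \<noteq> v \<Longrightarrow> hermitian (edge_mat u v w)"
  unfolding hermitian_def
proof (intro allI)
  fix a b assume "u \<noteq> v"
  then show "cnj (edge_mat u v w a b) = edge_mat u v w b a"
    by (cases "a = u"; cases "b = u"; cases "a = v"; cases "b = v") (simp_all add: edge_mat_def)
qed

lemma qform_hermitian_real:
  assumes "hermitian M" shows "Im (qform n M x) = 0"
proof -
  have "cnj (qform n M x) = (\<Sum>i<n. \<Sum>j<n. cnj (x j) * M j i * x i)"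
    using assms by (simp add: qform_def hermitian_def cnj_sum mult_ac)
  also have "\<dots> = qform n M x" unfolding qform_def by (rule sum.swap)
  finally show ?thesis by (metis cnj.sel(2) neg_equal_zero)
qed

text \<open>The form of a Hermitian matrix is real, so the imaginary part comes from
  \<open>z\<close> alone. This brings evaluation at points of the upper half-plane under the
  nonvanishing result for averages.\<close>

lemma posim_scal_add_hermitian:
  assumes "hermitian M" "Im z > 0"
  shows "posim n (\<lambda>a b. scal_mat z a b + M a b)"
  unfolding posim_def
proof (intro allI impI)
  fix x :: "nat \<Rightarrow> complex" assume "\<exists>i<n. x i \<noteq> 0"
  then obtain i where i: "i < n" "x i \<noteq> 0" by blast
  have "(\<Sum>j<n. cnj (x i) * scal_mat z i j * x j) = (if i < n then z * of_real ((cmod (x i))\<^sup>2) else 0)" for i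
  proof -
    have "(\<Sum>j<n. cnj (x i) * scal_mat z i j * x j) = (\<Sum>j<n. if i = j then cnj (x i) * z * x i else 0)"
      by (intro sum.cong) (auto simp: scal_mat_def)
    then show ?thesis by (simp add: complex_norm_square mult_ac del: of_real_power)
  qed
  then have "qform n (scal_mat z) x = z * of_real (\<Sum>i<n. (cmod (x i))\<^sup>2)"
    by (simp add: qform_def sum_distrib_left)
  moreover have "(\<Sum>i<n. (cmod (x i))\<^sup>2) > 0" using i by (intro sum_pos2[of _ i]) auto
  ultimately have "Im (qform n (scal_mat z) x) > 0" using assms by simp
  moreover have "qform n (\<lambda>a b. scal_mat z a b + M a b) x = qform n (scal_mat z) x + qform n M x"
    using qform_add[of n "scal_mat z" 1 M x] by simp
  ultimately show "Im (qform n (\<lambda>a b. scal_mat z a b + M a b) x) > 0"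
    using qform_hermitian_real[OF assms(1)] by simp
qed

text \<open>For \<open>D \<noteq> 0\<close> the only zero in \<open>t\<close> is
  \<open>- g / D\<close>. It must lie in the open lower half-plane, and its imaginary part has the
  sign of \<open>Im (D * cnj g)\<close>.\<close>

lemma Im_mult_cnj_neg:
  assumes "\<And>t. Im t \<ge> 0 \<Longrightarrow> g + t * D \<noteq> (0::complex)"
  shows "D = 0 \<or> Im (D * cnj g) < 0"
proof (cases "D = 0")
  case False
  have "\<not> Im (- g / D) \<ge> 0" using assms[of "- g / D"] False by auto
  moreover have "- g / D = of_real (inverse ((cmod D)\<^sup>2)) * (- g * cnj D)"
    using False by (simp add: complex_norm_square field_simps del: of_real_power)
  then have "Im (- g / D) = inverse ((cmod D)\<^sup>2) * Im (D * cnj g)"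
    by (simp del: of_real_inverse of_real_power) (simp add: algebra_simps)
  moreover have "inverse ((cmod D)\<^sup>2) > 0" using False by simp
  ultimately show ?thesis by (smt (verit) mult_nonneg_nonneg)
qed simp

lemma mdet_poly:
  "\<exists>p. degree p = n \<and> lead_coeff p = 1 \<and> (\<forall>z. mdet n (\<lambda>a b. scal_mat z a b + M a b) = poly p z)"
proof -
  let ?A = "mat n n (\<lambda>(a, b). - M a b)"
  have A: "?A \<in> carrier_mat n n" by simp
  have "mdet n (\<lambda>a b. scal_mat z a b + M a b) = poly (char_poly ?A) z" for z
    unfolding char_poly_def mdet_def
    by (rule poly_det_cong[symmetric, of _ n]) (auto simp: char_poly_matrix_def scal_mat_def)
  then show ?thesis using degree_monic_char_poly[OF A] by (intro exI[of _ "char_poly ?A"]) auto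
qed

lemma hermitian_scal_add: "hermitian M \<Longrightarrow> hermitian (\<lambda>a b. scal_mat (of_real x) a b + M a b)"
  by (auto simp: hermitian_def scal_mat_def)

section \<open>Fixing the edge weights one at a time\<close>

locale edge_choices =
  fixes n k :: nat and w :: "nat \<times> nat \<Rightarrow> nat \<Rightarrow> complex"
  assumes k: "k > 0" and norm_w: "\<And>e m. m < k \<Longrightarrow> cmod (w e m) = 1"
begin

abbreviation "avg es \<equiv> edge_avg k w es (mdet n)"

abbreviation "valid e \<equiv> fst e < n \<and> snd e < n \<and> fst e \<noteq> snd e"

definition em :: "nat \<times> nat \<Rightarrow> nat \<Rightarrow> nat \<Rightarrow> nat \<Rightarrow> complex" where
  "em e m = edge_mat (fst e) (snd e) (w e m)"

lemma edge_avg_Cons: "edge_avg k w (e # es) \<phi> M = (\<Sum>m<k. edge_avg k w es \<phi> (\<lambda>a b. M a b - em e m a b)) / of_nat k"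
  by (simp add: em_def)

text \<open>Averages are affine along a single edge matrix (\<open>avg_affine\<close>), so this
  difference is the derivative in that direction.\<close>

definition slope :: "(nat \<times> nat) list \<Rightarrow> nat \<times> nat \<Rightarrow> nat \<Rightarrow> (nat \<Rightarrow> nat \<Rightarrow> complex) \<Rightarrow> complex" where
  "slope es e m M = avg es (\<lambda>a b. M a b + em e m a b) - avg es M"

lemma avg_affine:
  assumes "valid e" "m < k"
  shows "avg es (\<lambda>a b. M a b + t * em e m a b) = avg es M + t * slope es e m M"
  using edge_avg_affine[of "mdet n" t "em e m" k w es M] mdet_edge_mat_affine[of "fst e" n "snd e" "w e m"] assms norm_w
  by (simp add: em_def slope_def algebra_simps)

lemma avg_minus:
  assumes "valid e" "m < k"
  shows "avg es (\<lambda>a b. M a b - em e m a b) = avg es M - slope es e m M"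
  using avg_affine[OF assms, of es M "-1"] by simp

text \<open>Adding \<open>t * em e m\<close> with \<open>Im t \<ge> 0\<close> stays inside
  \<open>posim\<close>, where the average has no zeros, so the affine function of \<open>t\<close>
  has its zero strictly below the real line.\<close>

lemma slope_Im_neg:
  assumes nz: "\<And>M. posim n M \<Longrightarrow> avg es M \<noteq> 0" and "valid e" "m < k" "posim n M"
  shows "slope es e m M = 0 \<or> Im (slope es e m M * cnj (avg es M)) < 0"
proof (rule Im_mult_cnj_neg)
  fix t :: complex assume "Im t \<ge> 0"
  then have "posim n (\<lambda>a b. M a b + t * em e m a b)"
    unfolding em_def using assms norm_w by (intro posim_add_edge_mat) auto
  from nz[OF this] show "avg es M + t * slope es e m M \<noteq> 0" using avg_affine assms by simp
qed

text \<open>If the next average vanished, then \<open>k * g\<close> would be the sum of the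
  \<open>D m\<close>. After multiplication by \<open>cnj g\<close> the left side is real, while
  every term on the right has negative imaginary part unless \<open>D m = 0\<close>. So all
  \<open>D m\<close> vanish, and with them \<open>g\<close>.\<close>

lemma avg_nonzero:
  assumes "\<And>e. e \<in> set es \<Longrightarrow> valid e" "posim n M"
  shows "avg es M \<noteq> 0"
  using assms
proof (induction es arbitrary: M)
  case Nil
  then show ?case by (simp add: mdet_nonzero)
next
  case (Cons e es)
  have nz: "posim n M \<Longrightarrow> avg es M \<noteq> 0" for M using Cons by simp
  have e: "valid e" using Cons.prems by simp
  define g where "g = avg es M"
  define D where "D m = slope es e m M" for m
  have g: "g \<noteq> 0" using nz Cons.prems by (simp add: g_def)
  have D: "D m = 0 \<or> Im (D m * cnj g) < 0" if "m < k" for m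
    unfolding D_def g_def by (rule slope_Im_neg[OF nz e that Cons.prems(2)])
  show ?case
  proof
    assume "avg (e # es) M = 0"
    then have "(\<Sum>m<k. g - D m) = 0"
      using k by (simp add: edge_avg_Cons avg_minus[OF e] g_def D_def del: edge_avg.simps)
    then have kg: "of_nat k * g = (\<Sum>m<k. D m)" by (simp add: sum_subtractf)
    then have "of_nat k * (g * cnj g) = (\<Sum>m<k. D m * cnj g)" by (simp add: sum_distrib_right[symmetric] mult.assoc[symmetric])
    then have "Im (of_nat k * (g * cnj g)) = (\<Sum>m<k. Im (D m * cnj g))" by (simp only: Im_sum)
    moreover have "Im (of_nat k * (g * cnj g)) = 0" by (simp add: complex_mult_cnj)
    ultimately have 0: "(\<Sum>m<k. - Im (D m * cnj g)) = 0" by (simp only: sum_negf)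
    have "\<forall>m\<in>{..<k}. - Im (D m * cnj g) = 0"
      using 0 by (subst (asm) sum_nonneg_eq_0_iff) (use D in force)+
    then have "D m = 0" if "m < k" for m using D[OF that] that by auto
    then have "of_nat k * g = 0" using kg by simp
    then show False using g k by simp
  qed
qed

lemma avg_poly:
  "\<exists>p. degree p = n \<and> lead_coeff p = 1 \<and> (\<forall>z. avg es (\<lambda>a b. scal_mat z a b + M a b) = poly p z)"
proof (induction es arbitrary: M)
  case Nil
  show ?case using mdet_poly by simp
next
  case (Cons e es)
  have "\<forall>m. \<exists>p. degree p = n \<and> lead_coeff p = 1 \<and> (\<forall>z. avg es (\<lambda>a b. scal_mat z a b + (M a b - em e m a b)) = poly p z)"
    by (intro allI Cons.IH)
  then obtain P where P: "\<And>m. degree (P m) = n" "\<And>m. lead_coeff (P m) = 1"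
    "\<And>m z. avg es (\<lambda>a b. scal_mat z a b + (M a b - em e m a b)) = poly (P m) z" by metis
  define p where "p = Polynomial.smult (1 / of_nat k) (\<Sum>m<k. P m)"
  have c: "coeff p n = 1" using k P by (simp add: p_def coeff_sum)
  have "degree p \<le> n" unfolding p_def by (intro degree_smult_le[THEN order_trans] degree_sum_le) (auto simp: P)
  then have d: "degree p = n" using c by (intro antisym le_degree) auto
  have "avg (e # es) (\<lambda>a b. scal_mat z a b + M a b) = poly p z" for z
    by (simp add: edge_avg_Cons add_diff_eq[symmetric] P p_def poly_sum del: edge_avg.simps)
  then show ?case using c d by (intro exI[of _ p]) auto
qed

lemma avg_real:
  assumes "\<And>e. e \<in> set es \<Longrightarrow> valid e" "hermitian M"
  shows "Im (avg es M) = 0"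
  using assms
proof (induction es arbitrary: M)
  case (Cons e es)
  have "hermitian (\<lambda>a b. M a b - em e m a b)" for m
    using Cons.prems hermitian_edge_mat[of "fst e" "snd e" "w e m"] by (simp add: hermitian_def em_def)
  then show ?case using Cons by (simp add: edge_avg_Cons del: edge_avg.simps)
qed (simp add: mdet_hermitian_real)

text \<open>With \<open>g\<close> the average that leaves \<open>e\<close> out, choice
  \<open>m\<close> yields \<open>P m = g - D m\<close>, where \<open>D m\<close> is the slope. All
  these polynomials are monic of degree \<open>n\<close>, which gives the degree condition of
  \<open>interlacing_selection\<close>; \<open>slope_Im_neg\<close> gives the Wronskian condition,
  and the hypothesis is positivity of the sum.\<close>

lemma choose_step:
  assumes ev: "\<And>e'. e' \<in> set (e # es) \<Longrightarrow> valid e'" and M: "hermitian M"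
    and pos: "\<And>x. x > lam \<Longrightarrow> Re (avg (e # es) (\<lambda>a b. scal_mat (of_real x) a b + M a b)) > 0"
  shows "\<exists>m<k. \<forall>x>lam. Re (avg es (\<lambda>a b. scal_mat (of_real x) a b + (M a b - em e m a b))) > 0"
proof -
  have e: "valid e" and es: "\<And>e'. e' \<in> set es \<Longrightarrow> valid e'" using ev by auto
  obtain g where g: "degree g = n" "lead_coeff g = 1"
    "\<And>z. avg es (\<lambda>a b. scal_mat z a b + M a b) = poly g z" using avg_poly[of es M] by blast
  have "\<forall>m. \<exists>p. degree p = n \<and> lead_coeff p = 1 \<and> (\<forall>z. avg es (\<lambda>a b. scal_mat z a b + (M a b - em e m a b)) = poly p z)"
    by (intro allI avg_poly)
  then obtain P where P: "\<And>m. degree (P m) = n" "\<And>m. lead_coeff (P m) = 1"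
    "\<And>m z. avg es (\<lambda>a b. scal_mat z a b + (M a b - em e m a b)) = poly (P m) z" by metis
  define D where "D m = g - P m" for m
  have Dslope: "poly (D m) z = slope es e m (\<lambda>a b. scal_mat z a b + M a b)" if "m < k" for m z
    using avg_minus[OF e that, of es "\<lambda>a b. scal_mat z a b + M a b"] g(3)[of z] P(3)[of z m]
    by (simp add: D_def add_diff_eq diff_eq_eq add.commute)
  have hM: "hermitian (\<lambda>a b. M a b - em e m a b)" for m
    using M e hermitian_edge_mat[of "fst e" "snd e" "w e m"] by (simp add: hermitian_def em_def)
  have gre: "Im (poly g (of_real x)) = 0" for x
    using avg_real[of es, OF es hermitian_scal_add[OF M, of x]] g(3) by simp
  have Pre: "Im (poly (P m) (of_real x)) = 0" for x m
    using avg_real[of es, OF es hermitian_scal_add[OF hM[of m], of x]] P(3) by simp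
  have mlc: "lead_coeff (map_poly Re g) > 0" "degree (map_poly Re g) = n"
  proof -
    have "coeff (map_poly Re g) n = 1" using g by (simp add: coeff_map_poly)
    moreover have "degree (map_poly Re g) \<le> n" using g(1) degree_map_poly_le[of Re g] by simp
    ultimately show "degree (map_poly Re g) = n" by (intro antisym le_degree) auto
    with \<open>coeff (map_poly Re g) n = 1\<close> show "lead_coeff (map_poly Re g) > 0" by simp
  qed
  have "\<exists>m\<in>{..<k}. \<forall>x>lam. 0 < poly (map_poly Re g - map_poly Re (D m)) x"
  proof (rule interlacing_selection)
    show "finite {..<k}" "{..<k} \<noteq> {}" using k by auto
    show "lead_coeff (map_poly Re g) > 0" by (rule mlc)
    show "map_poly Re (D m) = 0 \<or> degree (map_poly Re (D m)) < degree (map_poly Re g)" for m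
    proof (cases "D m = 0")
      case False
      have "coeff (D m) n = 0" using g P[of m] by (simp add: D_def)
      moreover have "degree (D m) \<le> n" using g P[of m] degree_diff_le[of g n "P m"] by (simp add: D_def)
      ultimately have "degree (D m) < n" using False by (metis leading_coeff_0_iff le_neq_implies_less)
      then show ?thesis using mlc degree_map_poly_le[of Re "D m"] by simp
    qed simp
    show "poly (pderiv (map_poly Re (D m))) x * poly (map_poly Re g) x
       - poly (map_poly Re (D m)) x * poly (pderiv (map_poly Re g)) x \<le> 0" if "m \<in> {..<k}" for m x
    proof (rule wronskian_nonpos)
      fix z :: complex assume z: "Im z > 0"
      show "Im (poly (D m) z * cnj (poly g z)) \<le> 0"
        using slope_Im_neg[of es e m, OF avg_nonzero[of es, OF es] e _ posim_scal_add_hermitian[OF M z]] that Dslope[of m z] g(3)[of z]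
        by auto
    qed (use gre Pre in \<open>simp_all add: D_def\<close>)
    show "0 < (\<Sum>m<k. poly (map_poly Re g - map_poly Re (D m)) x)" if "x > lam" for x
    proof -
      have "Re (avg (e # es) (\<lambda>a b. scal_mat (of_real x) a b + M a b)) = (\<Sum>m<k. Re (poly (P m) (of_real x))) / real k"
        by (simp add: edge_avg_Cons add_diff_eq[symmetric] P del: edge_avg.simps)
      then have "0 < (\<Sum>m<k. Re (poly (P m) (of_real x)))"
        using pos[OF that] k by (simp add: zero_less_divide_iff)
      then show ?thesis by (simp add: poly_map_Re D_def)
    qed
  qed
  then show ?thesis by (auto simp: poly_map_Re D_def P)
qed

lemma exists_choice:
  assumes "\<And>e. e \<in> set es \<Longrightarrow> valid e" "hermitian M" "distinct es"
    and "\<And>x. x > lam \<Longrightarrow> Re (avg es (\<lambda>a b. scal_mat (of_real x) a b + M a b)) > 0"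
  shows "\<exists>t. (\<forall>e. t e < k) \<and>
     (\<forall>x>lam. Re (mdet n (\<lambda>a b. scal_mat (of_real x) a b + (M a b - (\<Sum>e\<in>set es. em e (t e) a b)))) > 0)"
  using assms
proof (induction es arbitrary: M)
  case Nil
  then show ?case using k by (intro exI[of _ "\<lambda>_. 0"]) simp
next
  case (Cons e es)
  from choose_step[OF Cons.prems(1,2,4)] obtain m where
    m: "m < k" "\<And>x. x > lam \<Longrightarrow> Re (avg es (\<lambda>a b. scal_mat (of_real x) a b + (M a b - em e m a b))) > 0"
    by blast
  have "hermitian (\<lambda>a b. M a b - em e m a b)"
    using Cons.prems(1)[of e] Cons.prems(2) hermitian_edge_mat[of "fst e" "snd e" "w e m"] by (simp add: hermitian_def em_def)
  from Cons.IH[OF _ this _ m(2)] Cons.prems obtain t where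
    t: "\<And>e. t e < k" "\<And>x. x > lam \<Longrightarrow> Re (mdet n (\<lambda>a b. scal_mat (of_real x) a b + (M a b - em e m a b - (\<Sum>e\<in>set es. em e (t e) a b)))) > 0"
    by auto
  have "(\<Sum>e'\<in>set (e # es). em e' ((t(e := m)) e') a b) = em e m a b + (\<Sum>e\<in>set es. em e (t e) a b)" for a b
    using Cons.prems(3) by (auto intro!: sum.cong)
  then show ?case using t m by (intro exI[of _ "t(e := m)"]) (simp add: diff_diff_eq)
qed

end

section \<open>The average is the matching polynomial\<close>

lemma edge_avg_sum:
  "edge_avg k w es (\<lambda>M. \<Sum>p\<in>P. c p * \<phi> p M) M = (\<Sum>p\<in>P. c p * edge_avg k w es (\<phi> p) M)"
proof (induction es arbitrary: M)
  case (Cons e es)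
  show ?case unfolding edge_avg.simps Cons.IH
    by (subst sum.swap) (simp add: sum_distrib_left sum_divide_distrib)
qed simp

lemma edge_avg_cmult: "edge_avg k w es (\<lambda>M. c * \<phi> M) M = c * edge_avg k w es \<phi> M"
  using edge_avg_sum[of k w es "\<lambda>_. c" "\<lambda>_. \<phi>" "{()}" M] by simp

lemma sum_Suc_mod: "k > 0 \<Longrightarrow> (\<Sum>m<k. f (Suc m mod k)) = (\<Sum>m<k. f m :: 'b :: comm_monoid_add)"
proof (cases k)
  case (Suc l)
  have "(\<Sum>m<k. f (Suc m mod k)) = (\<Sum>m<l. f (Suc m)) + f 0"
    unfolding Suc sum.lessThan_Suc by (intro arg_cong2[where f = "(+)"] sum.cong) auto
  also have "\<dots> = (\<Sum>m<k. f m)" unfolding Suc sum.lessThan_Suc_shift by (simp add: add.commute)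
  finally show ?thesis .
qed simp

text \<open>
  Rotating the weight of one edge permutes the available choices, so it leaves averages unchanged;
  but it multiplies by \<open>\<zeta>\<close> the contribution of a permutation that uses the edge in one direction
  only. Hence only involutions survive the averaging.
\<close>

definition twist :: "nat \<Rightarrow> nat \<Rightarrow> complex \<Rightarrow> (nat \<Rightarrow> nat \<Rightarrow> complex) \<Rightarrow> nat \<Rightarrow> nat \<Rightarrow> complex" where
  "twist i j \<zeta> M a b = (if a = i \<and> b = j then \<zeta> * M a b else if a = j \<and> b = i then cnj \<zeta> * M a b else M a b)"

lemma twist_diff: "twist i j \<zeta> (\<lambda>a b. M a b - N a b) = (\<lambda>a b. twist i j \<zeta> M a b - twist i j \<zeta> N a b)"
  by (intro ext) (simp add: twist_def right_diff_distrib)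

lemma twist_scal_mat: "i \<noteq> j \<Longrightarrow> twist i j \<zeta> (scal_mat z) = scal_mat z"
  by (intro ext) (auto simp: twist_def scal_mat_def)

lemma twist_edge_mat:
  assumes "i \<noteq> j" "u \<noteq> v"
  shows "twist i j \<zeta> (edge_mat u v w) =
    (if u = i \<and> v = j then edge_mat u v (\<zeta> * w) else if u = j \<and> v = i then edge_mat u v (cnj \<zeta> * w) else edge_mat u v w)"
proof (intro ext)
  fix a b
  have *: "edge_mat u v w a b = 0" if "a \<noteq> b" "\<not> (a = u \<and> b = v)" "\<not> (a = v \<and> b = u)" for w a b
    using that by (auto simp: edge_mat_def)
  consider "a = b" | "a = u" "b = v" | "a = v" "b = u" | "a \<noteq> b" "\<not> (a = u \<and> b = v)" "\<not> (a = v \<and> b = u)" by blast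
  then show "twist i j \<zeta> (edge_mat u v w) a b = (if u = i \<and> v = j then edge_mat u v (\<zeta> * w) else if u = j \<and> v = i then edge_mat u v (cnj \<zeta> * w) else edge_mat u v w) a b"
  proof cases
    case 1
    then show ?thesis using assms by (auto simp: twist_def edge_mat_def)
  next
    case 2
    then show ?thesis using assms by (auto simp: twist_def edge_mat_def)
  next
    case 3
    then show ?thesis using assms by (auto simp: twist_def edge_mat_def)
  next
    case 4
    have "edge_mat u v y a b = 0" for y using 4 by (rule *)
    then show ?thesis by (simp only: twist_def if_distribR mult_zero_right if_cancel)
  qed
qed

text \<open>The weight of \<open>e\<close> runs through \<open>c e\<close> times the powers of
  \<open>\<zeta>\<close>, and has mean zero because \<open>\<zeta> \<noteq> 1\<close>. The factor
  \<open>c\<close> carries what earlier choices have fixed: it is 1 in a first run and a power of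
  \<open>\<i>\<close> when upper bits are chosen.\<close>

locale root_choices =
  fixes n k :: nat and \<zeta> :: complex and c :: "nat \<times> nat \<Rightarrow> complex"
  assumes k: "k > 0" and root: "\<zeta> ^ k = 1" "\<zeta> \<noteq> 1" and c: "\<And>e. cmod (c e) = 1"
begin

lemma norm_root: "cmod \<zeta> = 1"
  by (rule norm_root_of_unity[OF k root(1)])

lemma cnj_root: "cnj \<zeta> * \<zeta> = 1"
  using mult_cnj_unit[OF norm_root] by (simp add: mult.commute)

definition wt :: "nat \<times> nat \<Rightarrow> nat \<Rightarrow> complex" where "wt e m = c e * \<zeta> ^ m"

sublocale edge_choices n k wt
  by unfold_locales (auto simp: wt_def norm_mult norm_power norm_root c k)

lemma wt_Suc: "wt e (Suc m mod k) = \<zeta> * wt e m"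
  by (simp add: wt_def power_mod_root[OF root(1)] mult_ac)

text \<open>The three cases are an edge listed as \<open>(i, j)\<close>, one listed as
  \<open>(j, i)\<close>, and any other edge. In the second the weight is multiplied by
  \<open>cnj \<zeta>\<close>, which is stated as undoing a rotation.\<close>

lemma twist_em:
  assumes "i \<noteq> j" "fst e \<noteq> snd e"
  shows "(\<forall>m. twist i j \<zeta> (em e m) = em e (Suc m mod k)) \<or> (\<forall>m. twist i j \<zeta> (em e (Suc m mod k)) = em e m)
     \<or> (\<forall>m. twist i j \<zeta> (em e m) = em e m)"
proof -
  have *: "cnj \<zeta> * (\<zeta> * z) = z" for z using cnj_root by (metis mult.assoc mult_1)
  show ?thesis using assms by (auto simp: em_def twist_edge_mat wt_Suc *)
qed

lemma avg_twist:
  assumes ij: "i \<noteq> j" and "\<And>e. e \<in> set es \<Longrightarrow> fst e \<noteq> snd e"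
  shows "edge_avg k wt es (\<lambda>M. \<phi> (twist i j \<zeta> M)) M = edge_avg k wt es \<phi> (twist i j \<zeta> M)"
  using assms(2)
proof (induction es arbitrary: M)
  case (Cons e es)
  define F where "F N = edge_avg k wt es \<phi> (\<lambda>a b. twist i j \<zeta> M a b - N a b)" for N
  have "(\<Sum>m<k. F (twist i j \<zeta> (em e m))) = (\<Sum>m<k. F (em e m))"
    using twist_em[OF ij, of e] Cons.prems
      sum_Suc_mod[OF k, of "\<lambda>m. F (em e m)"] sum_Suc_mod[OF k, of "\<lambda>m. F (twist i j \<zeta> (em e m))"] by auto
  then show ?case using Cons by (simp add: edge_avg_Cons twist_diff F_def del: edge_avg.simps)
qed simp

lemma avg_perm_vanish:
  assumes p: "p permutes {..<n}" and i: "i < n" "p (p i) \<noteq> i"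
    and es: "\<And>e. e \<in> set es \<Longrightarrow> fst e \<noteq> snd e"
  shows "edge_avg k wt es (\<lambda>M. \<Prod>i<n. M i (p i)) (scal_mat z) = 0"
proof -
  let ?\<phi> = "\<lambda>M :: nat \<Rightarrow> nat \<Rightarrow> complex. \<Prod>i<n. M i (p i)"
  have ij: "i \<noteq> p i" using i(2) by auto
  \<comment> \<open>As \<open>p (p i) \<noteq> i\<close>, the product uses the entry
    \<open>(i, p i)\<close> but not its mirror image, so exactly one factor gains
    \<open>\<zeta>\<close> and no \<open>cnj \<zeta>\<close> compensates it.\<close>
  have "?\<phi> (twist i (p i) \<zeta> M) = \<zeta> * ?\<phi> M" for M
  proof -
    have "?\<phi> (twist i (p i) \<zeta> M) = \<zeta> * M i (p i) * (\<Prod>a\<in>{..<n}-{i}. M a (p a))"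
      using i ij by (subst prod.remove[of _ i]) (auto simp: twist_def intro!: prod.cong split: if_splits)
    also have "\<dots> = \<zeta> * ?\<phi> M" using i by (simp add: prod.remove[of "{..<n}" i] mult.assoc)
    finally show ?thesis .
  qed
  then have "\<zeta> * edge_avg k wt es ?\<phi> (scal_mat z) = edge_avg k wt es ?\<phi> (scal_mat z)"
    using avg_twist[OF ij es, of es ?\<phi> "scal_mat z"] by (simp add: edge_avg_cmult twist_scal_mat[OF ij])
  then show ?thesis using root(2) by simp
qed

text \<open>Meant for the terms of involutions: there each weight meets its own conjugate, so the
  product is the same for all choices.\<close>

lemma avg_const:
  assumes "distinct es" "\<And>t. (\<And>e. t e < k) \<Longrightarrow> \<phi> (\<lambda>a b. M a b - (\<Sum>e\<in>set es. em e (t e) a b)) = C"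
  shows "edge_avg k wt es \<phi> M = C"
  using assms
proof (induction es arbitrary: M)
  case Nil
  then show ?case using k Nil(2)[of "\<lambda>_. 0"] by simp
next
  case (Cons e es)
  have "edge_avg k wt es \<phi> (\<lambda>a b. M a b - em e m a b) = C" if m: "m < k" for m
  proof (rule Cons.IH)
    fix t :: "nat \<times> nat \<Rightarrow> nat" assume t: "\<And>e. t e < k"
    have "(\<Sum>e'\<in>set (e # es). em e' ((t(e := m)) e') a b) = em e m a b + (\<Sum>e\<in>set es. em e (t e) a b)" for a b
      using Cons.prems(1) by (auto intro!: sum.cong)
    with Cons.prems(2)[of "t(e := m)"] t m
    show "\<phi> (\<lambda>a b. M a b - em e m a b - (\<Sum>e\<in>set es. em e (t e) a b)) = C" by (simp add: diff_diff_eq)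
  qed (use Cons.prems in simp)
  then show ?case using k by (simp add: edge_avg_Cons del: edge_avg.simps)
qed

end

section \<open>Matching polynomials and the Heilmann-Lieb bound\<close>

lemma prod_involution:
  fixes N :: "nat \<Rightarrow> nat \<Rightarrow> 'b :: comm_monoid_mult"
  assumes p: "p permutes S" "p \<circ> p = id" and S: "finite S"
  shows "(\<Prod>i\<in>S. N i (p i)) = (\<Prod>i\<in>{i\<in>S. p i = i}. N i i) * (\<Prod>i\<in>{i\<in>S. i < p i}. N i (p i) * N (p i) i)"
proof -
  have pp: "p (p i) = i" for i using p(2) by (metis comp_apply id_apply)
  have pS: "p i \<in> S \<longleftrightarrow> i \<in> S" for i using permutes_in_image[OF p(1)] .
  have "S = {i\<in>S. p i = i} \<union> ({i\<in>S. i < p i} \<union> {i\<in>S. p i < i})" by auto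
  then have "(\<Prod>i\<in>S. N i (p i)) = (\<Prod>i\<in>{i\<in>S. p i = i} \<union> ({i\<in>S. i < p i} \<union> {i\<in>S. p i < i}). N i (p i))" by simp
  also have "\<dots> = (\<Prod>i\<in>{i\<in>S. p i = i}. N i (p i)) * ((\<Prod>i\<in>{i\<in>S. i < p i}. N i (p i)) * (\<Prod>i\<in>{i\<in>S. p i < i}. N i (p i)))"
    using S by (subst prod.union_disjoint, simp, simp, force, subst prod.union_disjoint) auto
  also have "(\<Prod>i\<in>{i\<in>S. p i < i}. N i (p i)) = (\<Prod>i\<in>{i\<in>S. i < p i}. N (p i) i)"
    by (rule prod.reindex_bij_witness[of _ p p]) (auto simp: pp pS)
  also have "(\<Prod>i\<in>{i\<in>S. p i = i}. N i (p i)) = (\<Prod>i\<in>{i\<in>S. p i = i}. N i i)" by (rule prod.cong) auto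
  finally show ?thesis by (simp add: prod.distrib)
qed

text \<open>
  For \<open>B\<close> with \<open>x\<close> on the diagonal and the adjacency matrix off it, an involution is a matching
  together with its uncovered vertices, and the sum below is the matching polynomial at \<open>x\<close>.
\<close>

definition involutions :: "nat set \<Rightarrow> (nat \<Rightarrow> nat) set" where
  "involutions S = {p. p permutes S \<and> p \<circ> p = id}"

definition matching_sum :: "(nat \<Rightarrow> nat \<Rightarrow> real) \<Rightarrow> nat set \<Rightarrow> real" where
  "matching_sum B S = (\<Sum>p\<in>involutions S. of_int (sign p) * (\<Prod>i\<in>S. B i (p i)))"

lemma finite_involutions: "finite S \<Longrightarrow> finite (involutions S)"
  unfolding involutions_def by (rule finite_subset[OF _ finite_permutations[of S]]) auto

lemma matching_sum_empty [simp]: "matching_sum B {} = 1"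
proof -
  have "involutions {} = {id}" by (auto simp: involutions_def permutes_empty)
  then show ?thesis by (simp add: matching_sum_def sign_id)
qed

text \<open>Composing with the transposition of \<open>u\<close> and \<open>v\<close> adds or
  removes the 2-cycle formed by them, and doing it twice changes nothing.\<close>

lemma involutions_moving:
  assumes "u \<in> S" "v \<notin> S"
  shows "bij_betw (\<lambda>q. transpose v u \<circ> q) (involutions (S - {u})) {p \<in> involutions (insert v S). p v = u}"
proof (rule bij_betw_byWitness[where f' = "\<lambda>p. transpose v u \<circ> p"])
  have uv: "u \<noteq> v" using assms by auto
  have tt: "transpose v u \<circ> (transpose v u \<circ> q) = q" for q :: "nat \<Rightarrow> nat"
    by (simp add: o_assoc)
  show "\<forall>q\<in>involutions (S - {u}). transpose v u \<circ> (transpose v u \<circ> q) = q" using tt by simp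
  show "\<forall>p\<in>{p \<in> involutions (insert v S). p v = u}. transpose v u \<circ> (transpose v u \<circ> p) = p" using tt by simp
  show "(\<lambda>q. transpose v u \<circ> q) ` involutions (S - {u}) \<subseteq> {p \<in> involutions (insert v S). p v = u}"
  proof clarify
    fix q assume "q \<in> involutions (S - {u})"
    then have q: "q permutes S - {u}" "q \<circ> q = id" by (auto simp: involutions_def)
    have qq: "q (q x) = x" for x using q(2) by (metis comp_apply id_apply)
    have fx: "q u = u" "q v = v" using permutes_not_in[OF q(1)] assms by auto
    have ne: "q x \<noteq> u" "q x \<noteq> v" if "x \<noteq> u" "x \<noteq> v" for x using that fx qq by metis+
    have "transpose v u permutes insert v S" using assms by (intro permutes_swap_id) auto
    moreover have "q permutes insert v S" by (rule permutes_subset[OF q(1)]) auto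
    ultimately have "transpose v u \<circ> q permutes insert v S" by (rule permutes_compose[rotated])
    moreover have "(transpose v u \<circ> q) \<circ> (transpose v u \<circ> q) = id"
    proof
      fix x show "((transpose v u \<circ> q) \<circ> (transpose v u \<circ> q)) x = id x"
        by (cases "x = u"; cases "x = v") (use uv in \<open>auto simp: fx qq ne\<close>)
    qed
    ultimately show "transpose v u \<circ> q \<in> involutions (insert v S) \<and> (transpose v u \<circ> q) v = u"
      by (simp add: involutions_def fx)
  qed
  show "(\<lambda>p. transpose v u \<circ> p) ` {p \<in> involutions (insert v S). p v = u} \<subseteq> involutions (S - {u})"
  proof clarify
    fix p assume "p \<in> involutions (insert v S)" and u: "u = p v"
    then have p: "p permutes insert v S" "p \<circ> p = id" by (auto simp: involutions_def)
    have pp: "p (p x) = x" for x using p(2) by (metis comp_apply id_apply)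
    have pu: "p u = v" using pp u by simp
    have ne: "p x \<noteq> u" "p x \<noteq> v" if "x \<noteq> u" "x \<noteq> v" for x using that u pu pp by metis+
    let ?q = "transpose v u \<circ> p"
    have "transpose v u permutes insert v S" using assms by (intro permutes_swap_id) auto
    then have q: "?q permutes insert v S" using p(1) by (rule permutes_compose[rotated])
    have "?q permutes S - {u}"
    proof (rule permutes_superset[OF q])
      fix x assume "x \<in> insert v S - (S - {u})"
      then have "x = v \<or> x = u" using assms by auto
      then show "?q x = x" using u[symmetric] pu by auto
    qed
    moreover have "?q \<circ> ?q = id"
    proof
      fix x show "(?q \<circ> ?q) x = id x"
        by (cases "x = u"; cases "x = v") (use uv u[symmetric] in \<open>auto simp: pu pp ne\<close>)
    qed
    ultimately show "transpose v (p v) \<circ> p \<in> involutions (S - {p v})" using u by (simp add: involutions_def)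
  qed
qed

text \<open>The deletion recurrence of the matching polynomial. Involutions are sorted by the image
  of \<open>v\<close>: it is fixed, or matched with some \<open>u\<close>, and then removing the
  2-cycle flips the sign.\<close>

lemma matching_sum_insert:
  assumes S: "finite S" "v \<notin> S"
  shows "matching_sum B (insert v S) = B v v * matching_sum B S
    - (\<Sum>u\<in>S. B v u * B u v * matching_sum B (S - {u}))"
proof -
  let ?W = "\<lambda>p. of_int (sign p) * (\<Prod>i\<in>insert v S. B i (p i))"
  define P where "P u = {p \<in> involutions (insert v S). p v = u}" for u
  have fin: "finite (P u)" for u unfolding P_def using S finite_involutions[of "insert v S"] by simp
  have "involutions (insert v S) = (\<Union>u\<in>insert v S. P u)"
    using permutes_in_image[of _ "insert v S" v] by (auto simp: P_def involutions_def)
  then have "matching_sum B (insert v S) = (\<Sum>p\<in>(\<Union>u\<in>insert v S. P u). ?W p)"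
    by (simp add: matching_sum_def)
  also have "\<dots> = (\<Sum>u\<in>insert v S. \<Sum>p\<in>P u. ?W p)"
    using S fin by (intro sum.UNION_disjoint) (auto simp: P_def)
  also have "\<dots> = (\<Sum>p\<in>P v. ?W p) + (\<Sum>u\<in>S. \<Sum>p\<in>P u. ?W p)" using S by simp
  also have "(\<Sum>p\<in>P v. ?W p) = B v v * matching_sum B S"
  proof -
    have "P v = involutions S"
    proof (rule Set.set_eqI, rule iffI)
      fix p assume "p \<in> P v"
      then have p: "p permutes insert v S" "p \<circ> p = id" "p v = v" by (auto simp: P_def involutions_def)
      have "p permutes S" by (rule permutes_superset[OF p(1)]) (use p in auto)
      then show "p \<in> involutions S" using p by (simp add: involutions_def)
    next
      fix p assume "p \<in> involutions S"
      then have p: "p permutes S" "p \<circ> p = id" by (auto simp: involutions_def)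
      then show "p \<in> P v" using permutes_not_in[OF p(1) S(2)] permutes_subset[OF p(1), of "insert v S"]
        by (auto simp: P_def involutions_def)
    qed
    moreover have "?W p = B v v * (of_int (sign p) * (\<Prod>i\<in>S. B i (p i)))" if "p \<in> P v" for p
      using that S by (simp add: P_def)
    ultimately show ?thesis by (simp add: matching_sum_def sum_distrib_left mult.left_commute)
  qed
  also have "(\<Sum>u\<in>S. \<Sum>p\<in>P u. ?W p) = (\<Sum>u\<in>S. - (B v u * B u v * matching_sum B (S - {u})))"
  proof (rule sum.cong[OF refl])
    fix u assume u: "u \<in> S"
    then have uv: "u \<noteq> v" using S by auto
    have "(\<Sum>p\<in>P u. ?W p) = (\<Sum>q\<in>involutions (S - {u}). ?W (transpose v u \<circ> q))"
      using sum.reindex_bij_betw[OF involutions_moving[OF u S(2)], of ?W] by (simp add: P_def)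
    also have "\<dots> = (\<Sum>q\<in>involutions (S - {u}). - (B v u * B u v) * (of_int (sign q) * (\<Prod>i\<in>S - {u}. B i (q i))))"
    proof (rule sum.cong[OF refl])
      fix q assume "q \<in> involutions (S - {u})"
      then have q: "q permutes S - {u}" "q \<circ> q = id" by (auto simp: involutions_def)
      have qq: "q (q x) = x" for x using q(2) by (metis comp_apply id_apply)
      have fx: "q u = u" "q v = v" using permutes_not_in[OF q(1)] S(2) by auto
      have ne: "q x \<noteq> u" "q x \<noteq> v" if "x \<noteq> u" "x \<noteq> v" for x using that fx qq by metis+
      have "permutation q" using q(1) S by (auto simp: permutation_permutes)
      then have sg: "sign (transpose v u \<circ> q) = - sign q"
        using uv by (simp add: sign_compose permutation_swap_id sign_swap_id)
      have "(\<Prod>i\<in>insert v S. B i ((transpose v u \<circ> q) i)) = B v u * (B u v * (\<Prod>i\<in>S - {u}. B i ((transpose v u \<circ> q) i)))"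
        using S u uv by (simp add: prod.remove[of S u] fx)
      also have "(\<Prod>i\<in>S - {u}. B i ((transpose v u \<circ> q) i)) = (\<Prod>i\<in>S - {u}. B i (q i))"
      proof (rule prod.cong[OF refl])
        fix i assume "i \<in> S - {u}"
        then have "i \<noteq> u" "i \<noteq> v" using S by auto
        then have "q i \<noteq> u" "q i \<noteq> v" using ne by blast+
        then show "B i ((transpose v u \<circ> q) i) = B i (q i)" by simp
      qed
      finally show "?W (transpose v u \<circ> q) = - (B v u * B u v) * (of_int (sign q) * (\<Prod>i\<in>S - {u}. B i (q i)))"
        by (simp add: sg)
    qed
    finally show "(\<Sum>p\<in>P u. ?W p) = - (B v u * B u v * matching_sum B (S - {u}))"
      by (simp add: matching_sum_def sum_distrib_left sum_negf)
  qed
  finally show ?thesis by (simp add: sum_negf)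
qed

definition matching_weight :: "(nat \<Rightarrow> nat \<Rightarrow> bool) \<Rightarrow> real \<Rightarrow> nat \<Rightarrow> nat \<Rightarrow> real" where
  "matching_weight adj x i j = (if i = j then x else if adj i j then 1 else 0)"

text \<open>
  With \<open>\<theta> = sqrt (d - 1)\<close> the induction carries the extra claim that deleting a vertex of degree at
  most \<open>d - 1\<close> decreases the matching polynomial at least by the factor \<open>\<theta>\<close>.
\<close>

theorem heilmann_lieb:
  fixes adj :: "nat \<Rightarrow> nat \<Rightarrow> bool" and d :: nat and x :: real
  assumes sym: "\<And>a b. adj a b \<Longrightarrow> adj b a"
    and U: "finite U" and deg: "\<And>a. a \<in> U \<Longrightarrow> card {b \<in> U. adj a b} \<le> d"
    and d: "d \<ge> 2" and x: "x > 2 * sqrt (real d - 1)"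
  shows "matching_sum (matching_weight adj x) U > 0"
proof -
  define \<theta> where "\<theta> = sqrt (real d - 1)"
  let ?m = "matching_sum (matching_weight adj x)"
  have \<theta>: "\<theta> > 0" "\<theta> * \<theta> = real d - 1" using d by (auto simp: \<theta>_def)
  have "?m S > 0 \<and> (\<forall>v\<in>S. card {u \<in> S. adj v u} \<le> d - 1 \<longrightarrow> \<theta> * ?m (S - {v}) \<le> ?m S)" if "S \<subseteq> U" for S
    using finite_subset[OF that U] that
  proof (induction S rule: finite_psubset_induct)
    case (psubset S)
    \<comment> \<open>Every neighbour \<open>u\<close> of \<open>v\<close> has lost the neighbour
      \<open>v\<close> in \<open>T\<close>, so its degree there is at most \<open>d - 1\<close> and
      the induction hypothesis bounds \<open>?m (T - {u})\<close> by \<open>?m T / \<theta>\<close>.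
      Inserted into the deletion recurrence, each neighbour costs at most
      \<open>1 / \<theta>\<close>.\<close>
    have step: "?m T > 0 \<and> (x - real (card {u \<in> T. adj v u \<and> u \<noteq> v}) / \<theta>) * ?m T \<le> ?m S"
      if v: "v \<in> S" and T: "T = S - {v}" for v T
    proof -
      have ST: "S = insert v T" "v \<notin> T" "T \<subset> S" "finite T" "T \<subseteq> U" using v T psubset.hyps psubset.prems by auto
      from psubset.IH[OF ST(3,5)] have IH: "?m T > 0"
        "\<And>u. u \<in> T \<Longrightarrow> card {t \<in> T. adj u t} \<le> d - 1 \<Longrightarrow> \<theta> * ?m (T - {u}) \<le> ?m T" by auto
      have le: "?m (T - {u}) \<le> ?m T / \<theta>" if u: "u \<in> T" "adj v u" for u
      proof -
        have "{t \<in> T. adj u t} \<subset> {t \<in> U. adj u t}" using u ST v psubset.prems sym[of v u] by auto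
        then have "card {t \<in> T. adj u t} < card {t \<in> U. adj u t}" using U by (intro psubset_card_mono) auto
        also have "\<dots> \<le> d" using u ST by (intro deg) auto
        finally have "\<theta> * ?m (T - {u}) \<le> ?m T" using u by (intro IH) auto
        then show ?thesis using \<theta> by (simp add: field_simps)
      qed
      have "?m S = x * ?m T - (\<Sum>u\<in>T. matching_weight adj x v u * matching_weight adj x u v * ?m (T - {u}))"
        unfolding ST(1) by (subst matching_sum_insert) (use ST in \<open>auto simp: matching_weight_def\<close>)
      also have "(\<Sum>u\<in>T. matching_weight adj x v u * matching_weight adj x u v * ?m (T - {u})) = (\<Sum>u\<in>{u \<in> T. adj v u \<and> u \<noteq> v}. ?m (T - {u}))"
        using ST sym by (intro sum.mono_neutral_cong_right) (auto simp: matching_weight_def)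
      finally have "?m S = x * ?m T - (\<Sum>u\<in>{u \<in> T. adj v u \<and> u \<noteq> v}. ?m (T - {u}))" .
      moreover have "(\<Sum>u\<in>{u \<in> T. adj v u \<and> u \<noteq> v}. ?m (T - {u})) \<le> (\<Sum>u\<in>{u \<in> T. adj v u \<and> u \<noteq> v}. ?m T / \<theta>)"
        by (intro sum_mono le) auto
      ultimately show ?thesis using IH(1) by (simp add: algebra_simps)
    qed
    have fS: "finite S" by (rule psubset.hyps)
    have A: "?m S > 0"
    proof (cases "S = {}")
      case False
      then obtain v where v: "v \<in> S" by blast
      define T where "T = S - {v}"
      let ?c = "card {u \<in> T. adj v u \<and> u \<noteq> v}"
      have "?c \<le> card {b \<in> U. adj v b}" using U psubset.prems by (intro card_mono) (auto simp: T_def)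
      also have "\<dots> \<le> d" using v psubset.prems by (intro deg) auto
      \<comment> \<open>Up to \<open>d\<close> neighbours are possible here;
        \<open>d \<ge> 2\<close> gives \<open>d \<le> 2 * (d - 1)\<close>, so their total cost
        \<open>d / \<theta>\<close> is at most \<open>2 * \<theta>\<close>, which is below
        \<open>x\<close>.\<close>
      finally have "real ?c \<le> 2 * (\<theta> * \<theta>)" using \<theta> d by simp
      also have "\<dots> < x * \<theta>"
        using mult_strict_right_mono[OF x[folded \<theta>_def] \<theta>(1)] by (simp only: mult.assoc)
      finally have "x - real ?c / \<theta> > 0" using \<theta> by (simp add: field_simps)
      then show ?thesis using step[OF v T_def] by (meson less_le_trans mult_pos_pos)
    qed simp
    have "\<theta> * ?m (S - {v}) \<le> ?m S" if v: "v \<in> S" and c: "card {u \<in> S. adj v u} \<le> d - 1" for v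
    proof -
      define T where "T = S - {v}"
      let ?c = "card {u \<in> T. adj v u \<and> u \<noteq> v}"
      have "?c \<le> card {u \<in> S. adj v u}" using fS by (intro card_mono) (auto simp: T_def)
      with c have "?c \<le> d - 1" by simp
      then have "real ?c \<le> \<theta> * \<theta>" using \<theta> d by (simp add: of_nat_diff)
      then have "real ?c / \<theta> \<le> \<theta>" using \<theta> by (simp add: field_simps)
      \<comment> \<open>The origin of the constant: \<open>d - 1\<close> neighbours cost at most
        \<open>\<theta>\<close>, and another \<open>\<theta>\<close> has to remain, so
        \<open>x\<close> must reach \<open>2 * \<theta>\<close>.\<close>
      then have "\<theta> \<le> x - real ?c / \<theta>" using x by (simp add: \<theta>_def)
      then have "\<theta> * ?m T \<le> (x - real ?c / \<theta>) * ?m T"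
        using step[OF v T_def] by (intro mult_right_mono) auto
      then show ?thesis using step[OF v T_def] unfolding T_def[symmetric] by linarith
    qed
    with A show ?case by blast
  qed
  then show ?thesis by blast
qed

section \<open>The averaged determinant of a regular graph\<close>

locale regular_choices = root_choices +
  fixes adj :: "nat \<Rightarrow> nat \<Rightarrow> bool" and d :: nat
  assumes sym: "\<And>a b. adj a b \<Longrightarrow> adj b a" and irrefl: "\<And>a. \<not> adj a a"
    and deg: "\<And>a. a < n \<Longrightarrow> card {b. b < n \<and> adj a b} = d" and d: "d \<ge> 2"
begin

definition hmat :: "(nat \<times> nat \<Rightarrow> nat) \<Rightarrow> nat \<Rightarrow> nat \<Rightarrow> complex" where
  "hmat t a b = (if \<not> adj a b then 0 else if a < b then wt (a, b) (t (a, b)) else cnj (wt (b, a) (t (b, a))))"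

definition edges :: "(nat \<times> nat) set" where
  "edges = {e. fst e < snd e \<and> snd e < n \<and> adj (fst e) (snd e)}"

lemma finite_edges: "finite edges"
  by (rule finite_subset[of _ "{..<n} \<times> {..<n}"]) (auto simp: edges_def)

lemma sum_em:
  assumes ab: "a < n" "b < n"
  shows "(\<Sum>e\<in>edges. em e (t e) a b) = hmat t a b + (if a = b then of_nat d else 0)"
proof -
  consider "a = b" | "a < b" | "b < a" by linarith
  then show ?thesis
  proof cases
    case 1
    have "(\<Sum>e\<in>edges. em e (t e) a a) = (\<Sum>e\<in>{e \<in> edges. fst e = a \<or> snd e = a}. 1)"
      using finite_edges by (intro sum.mono_neutral_cong_right) (auto simp: em_def edge_mat_def)
    also have "\<dots> = of_nat (card {e \<in> edges. fst e = a \<or> snd e = a})" by simp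
    also have "card {e \<in> edges. fst e = a \<or> snd e = a} = card {b. b < n \<and> adj a b}"
    proof (rule bij_betw_same_card[symmetric])
      show "bij_betw (\<lambda>b. if a < b then (a, b) else (b, a)) {b. b < n \<and> adj a b} {e \<in> edges. fst e = a \<or> snd e = a}"
      proof (rule bij_betw_byWitness[where f' = "\<lambda>e. if fst e = a then snd e else fst e"])
        show "(\<lambda>b. if a < b then (a, b) else (b, a)) ` {b. b < n \<and> adj a b} \<subseteq> {e \<in> edges. fst e = a \<or> snd e = a}"
        proof (rule image_subsetI)
          fix b assume "b \<in> {b. b < n \<and> adj a b}"
          then have b: "b < n" "adj a b" by auto
          then have "a \<noteq> b" using irrefl by blast
          with b ab sym[of a b] show "(if a < b then (a, b) else (b, a)) \<in> {e \<in> edges. fst e = a \<or> snd e = a}"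
            by (auto simp: edges_def)
        qed
        show "(\<lambda>e. if fst e = a then snd e else fst e) ` {e \<in> edges. fst e = a \<or> snd e = a} \<subseteq> {b. b < n \<and> adj a b}"
          using sym by (auto simp: edges_def)
      qed (auto simp: edges_def)
    qed
    finally show ?thesis using 1 ab deg irrefl by (simp add: hmat_def)
  next
    case 2
    have "em e (t e) a b = (if e = (a, b) then wt (a, b) (t (a, b)) else 0)" if "e \<in> edges" for e
      using that 2 by (cases e) (auto simp: em_def edge_mat_def edges_def)
    then have "(\<Sum>e\<in>edges. em e (t e) a b) = (\<Sum>e\<in>edges. if e = (a, b) then wt (a, b) (t (a, b)) else 0)"
      by (intro sum.cong) auto
    then show ?thesis using 2 ab finite_edges by (simp add: hmat_def edges_def)
  next
    case 3
    have "em e (t e) a b = (if e = (b, a) then cnj (wt (b, a) (t (b, a))) else 0)" if "e \<in> edges" for e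
      using that 3 by (cases e) (auto simp: em_def edge_mat_def edges_def)
    then have "(\<Sum>e\<in>edges. em e (t e) a b) = (\<Sum>e\<in>edges. if e = (b, a) then cnj (wt (b, a) (t (b, a))) else 0)"
      by (intro sum.cong) auto
    then show ?thesis using 3 ab finite_edges sym by (auto simp: hmat_def edges_def)
  qed
qed

lemma hmat_mult_swap:
  assumes "\<And>e. t e < k"
  shows "hmat t a b * hmat t b a = (if adj a b then 1 else 0)"
proof -
  have "wt e m * cnj (wt e m) = 1" if "m < k" for e m
    using norm_w[OF that] by (rule mult_cnj_unit)
  then show ?thesis using assms sym[of a b] sym[of b a] irrefl[of a]
    by (cases a b rule: linorder_cases) (auto simp: hmat_def mult.commute)
qed

text \<open>The offset \<open>d\<close> cancels the diagonal of the sum of edge matrices.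
  Permutations that are not involutions average to 0. For an involution, a 2-cycle along an edge
  contributes a weight times its conjugate, with two minus signs that cancel, so every choice gives
  the same value as the unweighted graph.\<close>

lemma avg_eq_matching_sum:
  assumes es: "set es = edges" "distinct es"
  shows "avg es (scal_mat (of_real (x + real d))) = of_real (matching_sum (matching_weight adj x) {..<n})"
proof -
  let ?\<phi> = "\<lambda>p M. \<Prod>i<n. M i (p i) :: complex"
  have "avg es (scal_mat z) = (\<Sum>p | p permutes {..<n}. of_int (sign p) * edge_avg k wt es (?\<phi> p) (scal_mat z))" for z
  proof -
    have "mdet n = (\<lambda>M. \<Sum>p | p permutes {..<n}. of_int (sign p) * ?\<phi> p M)" by (intro ext mdet_perm)
    then show ?thesis by (simp only: edge_avg_sum)
  qed
  also have "(\<Sum>p | p permutes {..<n}. of_int (sign p) * edge_avg k wt es (?\<phi> p) (scal_mat (of_real (x + real d))))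
     = (\<Sum>p\<in>involutions {..<n}. of_real (of_int (sign p) * (\<Prod>i<n. matching_weight adj x i (p i))))"
  proof (rule sum.mono_neutral_cong_right)
    show "finite {p. p permutes {..<n}}" by (simp add: finite_permutations)
    show "involutions {..<n} \<subseteq> {p. p permutes {..<n}}" by (auto simp: involutions_def)
    show "\<forall>p\<in>{p. p permutes {..<n}} - involutions {..<n}. of_int (sign p) * edge_avg k wt es (?\<phi> p) (scal_mat (of_real (x + real d))) = 0"
    proof
      fix p assume "p \<in> {p. p permutes {..<n}} - involutions {..<n}"
      then have p: "p permutes {..<n}" "p \<circ> p \<noteq> id" by (auto simp: involutions_def)
      then obtain i where i: "p (p i) \<noteq> i" by (auto simp: fun_eq_iff)
      then have "i < n" using permutes_not_in[OF p(1), of i] by force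
      then have "edge_avg k wt es (?\<phi> p) (scal_mat (of_real (x + real d))) = 0"
        using p i es by (intro avg_perm_vanish) (auto simp: edges_def)
      then show "of_int (sign p) * edge_avg k wt es (?\<phi> p) (scal_mat (of_real (x + real d))) = 0" by simp
    qed
    fix p assume "p \<in> involutions {..<n}"
    then have p: "p permutes {..<n}" "p \<circ> p = id" by (auto simp: involutions_def)
    have "edge_avg k wt es (?\<phi> p) (scal_mat (of_real (x + real d))) = of_real (\<Prod>i<n. matching_weight adj x i (p i))"
    proof (rule avg_const[OF es(2)])
      fix t :: "nat \<times> nat \<Rightarrow> nat" assume t: "\<And>e. t e < k"
      define N where "N a b = scal_mat (of_real (x + real d)) a b - (\<Sum>e\<in>set es. em e (t e) a b)" for a b
      have N: "N a b = (if a = b then of_real x else - hmat t a b)" if "a < n" "b < n" for a b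
        using that irrefl by (simp add: N_def es sum_em scal_mat_def hmat_def)
      have pn: "p i < n" if "i < n" for i using that permutes_in_image[OF p(1)] by auto
      have "(\<Prod>i<n. N i (p i)) = (\<Prod>i\<in>{i\<in>{..<n}. p i = i}. N i i) * (\<Prod>i\<in>{i\<in>{..<n}. i < p i}. N i (p i) * N (p i) i)"
        by (rule prod_involution[OF p]) simp
      also have "(\<Prod>i\<in>{i\<in>{..<n}. p i = i}. N i i) = (\<Prod>i\<in>{i\<in>{..<n}. p i = i}. of_real (matching_weight adj x i i))"
        by (intro prod.cong) (auto simp: N matching_weight_def)
      also have "(\<Prod>i\<in>{i\<in>{..<n}. i < p i}. N i (p i) * N (p i) i) =
        (\<Prod>i\<in>{i\<in>{..<n}. i < p i}. of_real (matching_weight adj x i (p i)) * of_real (matching_weight adj x (p i) i))"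
        using pn sym by (intro prod.cong refl) (auto simp: N matching_weight_def hmat_mult_swap[OF t])
      also have "(\<Prod>i\<in>{i\<in>{..<n}. p i = i}. of_real (matching_weight adj x i i)) * \<dots> = (\<Prod>i<n. complex_of_real (matching_weight adj x i (p i)))"
        by (rule prod_involution[OF p, symmetric]) simp
      finally show "(\<Prod>i<n. scal_mat (of_real (x + real d)) i (p i) - (\<Sum>e\<in>set es. em e (t e) i (p i))) = of_real (\<Prod>i<n. matching_weight adj x i (p i))"
        by (simp add: N_def)
    qed
    then show "of_int (sign p) * edge_avg k wt es (?\<phi> p) (scal_mat (of_real (x + real d))) =
      of_real (of_int (sign p) * (\<Prod>i<n. matching_weight adj x i (p i)))" by simp
  qed
  finally show ?thesis by (simp add: matching_sum_def)
qed

theorem exists_good_choice: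
  "\<exists>t. (\<forall>e. t e < k) \<and>
     (\<forall>x > 2 * sqrt (real d - 1). Re (mdet n (\<lambda>a b. scal_mat (of_real x) a b - hmat t a b)) > 0)"
proof -
  obtain es where es: "set es = edges" "distinct es" using finite_distinct_list[OF finite_edges] by blast
  \<comment> \<open>The chosen edge matrices add up to \<open>d I\<close> plus the weighted
    adjacency matrix, so the bound for the latter is moved by \<open>d\<close>.\<close>
  define lam where "lam = 2 * sqrt (real d - 1) + real d"
  have "\<exists>t. (\<forall>e. t e < k) \<and>
     (\<forall>x>lam. Re (mdet n (\<lambda>a b. scal_mat (of_real x) a b + (0 - (\<Sum>e\<in>set es. em e (t e) a b)))) > 0)"
  proof (rule exists_choice)
    show "valid e" if "e \<in> set es" for e using that es by (auto simp: edges_def)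
    show "hermitian (\<lambda>a b. 0)" by (simp add: hermitian_def)
    show "distinct es" by (rule es)
    fix x assume x: "x > lam"
    have "matching_sum (matching_weight adj (x - real d)) {..<n} > 0"
      by (rule heilmann_lieb[where d = d]) (use sym deg d x in \<open>auto simp: lam_def\<close>)
    then show "Re (avg es (\<lambda>a b. scal_mat (of_real x) a b + 0)) > 0"
      using avg_eq_matching_sum[OF es, of "x - real d"] by simp
  qed
  then obtain t where t: "\<And>e. t e < k"
    "\<And>x. x > lam \<Longrightarrow> Re (mdet n (\<lambda>a b. scal_mat (of_real x) a b + (0 - (\<Sum>e\<in>set es. em e (t e) a b)))) > 0" by blast
  have "Re (mdet n (\<lambda>a b. scal_mat (of_real x) a b - hmat t a b)) > 0" if "x > 2 * sqrt (real d - 1)" for x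
  proof -
    have "mdet n (\<lambda>a b. scal_mat (of_real (x + real d)) a b + (0 - (\<Sum>e\<in>set es. em e (t e) a b)))
       = mdet n (\<lambda>a b. scal_mat (of_real x) a b - hmat t a b)"
      by (rule mdet_cong) (auto simp: es sum_em scal_mat_def)
    then show ?thesis using t(2)[of "x + real d"] that by (simp add: lam_def)
  qed
  with t show ?thesis by blast
qed

end

section \<open>The spectrum of a shift lift\<close>

lemma mdet_block_diag:
  fixes f :: "nat \<Rightarrow> nat \<Rightarrow> nat \<Rightarrow> complex"
  shows "mdet (m * n) (\<lambda>a b. if a div n = b div n then f (a div n) (a mod n) (b mod n) else 0)
       = (\<Prod>l<m. mdet n (f l))"
proof (cases "n = 0")
  case True
  then show ?thesis by (simp add: mdet_def)
next
  case False
  then have n: "n > 0" by simp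
  show ?thesis
  proof (induction m)
    case (Suc m)
    let ?g = "\<lambda>a b. if a div n = b div n then f (a div n) (a mod n) (b mod n) else 0"
    let ?A = "mat (m * n) (m * n) (\<lambda>(a, b). ?g a b)" and ?D = "mat n n (\<lambda>(a, b). f m a b)"
    have div: "a < m * n \<Longrightarrow> a div n < m" for a using n by (simp add: less_mult_imp_div_less)
    have div': "a div n = m \<and> a mod n = a - m * n" if "m * n \<le> a" "a < n + m * n" for a
    proof -
      from that have "a = (a - m * n) + m * n" "a - m * n < n" by auto
      then show ?thesis using n by (metis div_mult_self3 div_less mod_mult_self3 mod_less add.commute add_0 not_less0)
    qed
    have "mat (Suc m * n) (Suc m * n) (\<lambda>(a, b). ?g a b) = four_block_mat ?A (0\<^sub>m (m * n) n) (0\<^sub>m n (m * n)) ?D"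
    proof (rule eq_matI, goal_cases)
      case (1 a b)
      then have ab: "a < n + m * n" "b < n + m * n" by auto
      show ?case
      proof (cases "a < m * n"; cases "b < m * n")
        assume "a < m * n" "b < m * n"
        then show ?thesis using ab by simp
      next
        assume "a < m * n" "\<not> b < m * n"
        then show ?thesis using ab div[of a] div'[of b] by simp
      next
        assume "\<not> a < m * n" "b < m * n"
        then show ?thesis using ab div[of b] div'[of a] by simp
      next
        assume "\<not> a < m * n" "\<not> b < m * n"
        then show ?thesis using ab div'[of a] div'[of b] by simp
      qed
    qed auto
    then have "mdet (Suc m * n) ?g = det ?A * det ?D"
      unfolding mdet_def by (simp only:, intro det_four_block_mat_upper_right_zero) auto
    then show ?case using Suc by (simp add: mdet_def mult.commute)
  qed (simp add: mdet_def)
qed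

lemma mdet_mult: "mdet N f * mdet N g = mdet N (\<lambda>a b. \<Sum>c<N. f a c * g c b)"
proof -
  have "mat N N (\<lambda>(a, b). f a b) * mat N N (\<lambda>(a, b). g a b) = mat N N (\<lambda>(a, b). \<Sum>c<N. f a c * g c b)"
    by (rule eq_matI) (auto simp: scalar_prod_def lessThan_atLeast0)
  then show ?thesis unfolding mdet_def by (subst det_mult[symmetric, of _ N]) auto
qed

lemma sum_grid:
  fixes k n :: nat
  shows "(\<Sum>c<k * n. f (c mod n) (c div n)) = (\<Sum>l<k. \<Sum>i<n. f i l :: 'b :: comm_monoid_add)"
proof (cases "n = 0")
  case False
  have "(\<Sum>c<k * n. f (c mod n) (c div n)) = (\<Sum>l<k. \<Sum>c = l * n..<l * n + n. f (c mod n) (c div n))"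
    by (rule sum.nat_group[symmetric])
  also have "\<dots> = (\<Sum>l<k. \<Sum>i<n. f i l)"
  proof (rule sum.cong[OF refl])
    fix l
    have "(\<Sum>c = l * n..<l * n + n. f (c mod n) (c div n)) = (\<Sum>i = 0..<n. f ((i + l * n) mod n) ((i + l * n) div n))"
      using sum.shift_bounds_nat_ivl[of "\<lambda>c. f (c mod n) (c div n)" 0 "l * n" n] by (simp add: add.commute)
    also have "\<dots> = (\<Sum>i<n. f i l)" using False by (simp add: lessThan_atLeast0)
    finally show "(\<Sum>c = l * n..<l * n + n. f (c mod n) (c div n)) = (\<Sum>i<n. f i l)" .
  qed
  finally show ?thesis .
qed simp

text \<open>The sum is geometric with ratio \<open>\<omega> ^ p * cnj \<omega> ^ l\<close>, a
  \<open>k\<close>-th root of unity that equals 1 only for \<open>p = l\<close>, by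
  primitivity.\<close>

lemma root_orthogonality:
  fixes \<omega> :: complex
  assumes k: "k > 0" and root: "\<omega> ^ k = 1" and prim: "\<And>m. 0 < m \<Longrightarrow> m < k \<Longrightarrow> \<omega> ^ m \<noteq> 1"
    and pl: "p < k" "l < k"
  shows "(\<Sum>q<k. \<omega> ^ (p * q) * cnj \<omega> ^ (q * l)) = (if p = l then of_nat k else 0)"
proof -
  have cn: "\<omega> * cnj \<omega> = 1" by (rule mult_cnj_unit[OF norm_root_of_unity[OF k root]])
  then have cnl: "\<omega> ^ l * cnj \<omega> ^ l = 1" for l by (simp add: power_mult_distrib[symmetric])
  define x where "x = \<omega> ^ p * cnj \<omega> ^ l"
  have "\<omega> ^ (p * q) * cnj \<omega> ^ (q * l) = x ^ q" for q
    by (simp add: x_def power_mult_distrib power_mult mult.commute[of q])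
  then have S: "(\<Sum>q<k. \<omega> ^ (p * q) * cnj \<omega> ^ (q * l)) = (\<Sum>q<k. x ^ q)" by simp
  show ?thesis
  proof (cases "p = l")
    case True
    then have "x = 1" using cnl by (simp add: x_def)
    then show ?thesis using S True by simp
  next
    case False
    have nz: "\<omega> \<noteq> 0" using cn by auto
    have "x \<noteq> 1"
    proof
      assume "x = 1"
      then have "\<omega> ^ l = \<omega> ^ p * (\<omega> ^ l * cnj \<omega> ^ l)" by (simp add: x_def mult_ac)
      then have eq: "\<omega> ^ l = \<omega> ^ p" using cnl by simp
      show False
      proof (cases "p < l")
        case True
        then have "\<omega> ^ (l - p) = 1" using eq nz by (simp add: power_diff)
        then show False using prim[of "l - p"] True pl by simp
      next
        case False
        then have "p > l" using \<open>p \<noteq> l\<close> by simp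
        then have "\<omega> ^ (p - l) = 1" using eq nz by (simp add: power_diff)
        then show False using prim[of "p - l"] \<open>p > l\<close> pl by simp
      qed
    qed
    moreover have "x ^ k = 1"
    proof -
      have "x ^ k = (\<omega> ^ k) ^ p * cnj (\<omega> ^ k) ^ l"
        by (simp add: x_def power_mult_distrib power_mult[symmetric] mult.commute)
      then show ?thesis using root by simp
    qed
    ultimately have "(\<Sum>q<k. x ^ q) = 0" using geometric_sum[of x k] by simp
    then show ?thesis using S False by simp
  qed
qed

text \<open>
  The vertex \<open>(i, p)\<close> of the lift has index \<open>p n + i\<close>. The discrete Fourier transform \<open>?P\<close> in the
  fibre coordinate block-diagonalises the adjacency matrix.
\<close>

lemma mdet_shift_lift:
  fixes \<omega> z :: complex and \<sigma> :: "nat \<Rightarrow> nat \<Rightarrow> nat"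
  assumes k: "k > 0" and root: "\<omega> ^ k = 1" and prim: "\<And>m. 0 < m \<Longrightarrow> m < k \<Longrightarrow> \<omega> ^ m \<noteq> 1"
  shows "mdet (k * n) (\<lambda>a b. scal_mat z a b -
       (if adj (a mod n) (b mod n) \<and> b div n = (a div n + \<sigma> (a mod n) (b mod n)) mod k then 1 else 0))
     = (\<Prod>l<k. mdet n (\<lambda>i j. scal_mat z i j - (if adj i j then \<omega> ^ (l * \<sigma> i j) else 0)))"
proof (cases "n = 0")
  case True
  then show ?thesis by (simp add: mdet_def)
next
  case False
  then have n: "n > 0" by simp
  define B where "B i p j q = (if adj i j \<and> q = (p + \<sigma> i j) mod k then 1 else 0 :: complex)" for i p j q
  define A where "A l i j = (if adj i j then \<omega> ^ (l * \<sigma> i j) else 0)" for l i j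
  let ?P = "\<lambda>a b. if a mod n = b mod n then \<omega> ^ (a div n * (b div n)) else 0"
  let ?Q = "\<lambda>a b. if a mod n = b mod n then cnj \<omega> ^ (a div n * (b div n)) / of_nat k else 0"
  let ?X = "\<lambda>a b. scal_mat z a b - B (a mod n) (a div n) (b mod n) (b div n)"
  let ?Y = "\<lambda>a b. scal_mat z a b - (if a div n = b div n then A (a div n) (a mod n) (b mod n) else 0)"
  have lt: "a div n < k" "a mod n < n" if "a < k * n" for a using that n by (auto simp: less_mult_imp_div_less)
  have eqi: "a = b \<longleftrightarrow> a mod n = b mod n \<and> a div n = b div n" for a b by (metis div_mult_mod_eq)
  have "mdet (k * n) ?P * mdet (k * n) ?Q = mdet (k * n) (\<lambda>a b. if a = b then 1 else 0)"
    unfolding mdet_mult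
  proof (rule mdet_cong)
    fix a b assume ab: "a < k * n" "b < k * n"
    have "(\<Sum>c<k * n. ?P a c * ?Q c b) = (\<Sum>q<k. \<Sum>i<n. (if a mod n = i then \<omega> ^ (a div n * q) else 0) *
        (if i = b mod n then cnj \<omega> ^ (q * (b div n)) / of_nat k else 0))"
      by (rule sum_grid)
    also have "\<dots> = (\<Sum>q<k. if a mod n = b mod n then \<omega> ^ (a div n * q) * cnj \<omega> ^ (q * (b div n)) / of_nat k else 0)"
    proof (rule sum.cong[OF refl])
      fix q
      have "(\<Sum>i<n. (if a mod n = i then \<omega> ^ (a div n * q) else 0) * (if i = b mod n then cnj \<omega> ^ (q * (b div n)) / of_nat k else 0))
         = (\<Sum>i<n. if i = b mod n then (if a mod n = b mod n then \<omega> ^ (a div n * q) * cnj \<omega> ^ (q * (b div n)) / of_nat k else 0) else 0)"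
        by (rule sum.cong) auto
      then show "(\<Sum>i<n. (if a mod n = i then \<omega> ^ (a div n * q) else 0) * (if i = b mod n then cnj \<omega> ^ (q * (b div n)) / of_nat k else 0))
        = (if a mod n = b mod n then \<omega> ^ (a div n * q) * cnj \<omega> ^ (q * (b div n)) / of_nat k else 0)"
        using lt[OF ab(2)] by simp
    qed
    also have "\<dots> = (if a mod n = b mod n then (\<Sum>q<k. \<omega> ^ (a div n * q) * cnj \<omega> ^ (q * (b div n))) / of_nat k else 0)"
      by (simp add: sum_divide_distrib)
    also have "(\<Sum>q<k. \<omega> ^ (a div n * q) * cnj \<omega> ^ (q * (b div n))) = (if a div n = b div n then of_nat k else 0)"
      using root_orthogonality[of k \<omega> "a div n" "b div n"] k root prim lt(1)[OF ab(1)] lt(1)[OF ab(2)] by blast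
    also have "(if a mod n = b mod n then (if a div n = b div n then of_nat k else 0) / of_nat k else 0) = (if a = b then 1 else 0 :: complex)"
      using k eqi[of a b] by auto
    finally show "(\<Sum>c<k * n. ?P a c * ?Q c b) = (if a = b then 1 else 0)" .
  qed
  also have "\<dots> = det (1\<^sub>m (k * n))" unfolding mdet_def by (rule arg_cong[where f = det]) (auto intro!: eq_matI)
  finally have P0: "mdet (k * n) ?P \<noteq> 0" by auto
  have scalL: "(\<Sum>c<k * n. scal_mat z a c * g c) = z * g a" if "a < k * n" for a g
    using that by (simp add: scal_mat_def if_distrib[of "\<lambda>x. x * _"] cong: if_cong)
  have scalR: "(\<Sum>c<k * n. g c * scal_mat z c b) = g b * z" if "b < k * n" for b g
    using that by (simp add: scal_mat_def if_distrib[of "\<lambda>x. _ * x"] cong: if_cong)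
  \<comment> \<open>\<open>?P\<close> intertwines the matrix of the lift with a block-diagonal one:
    a shift of the fibre by \<open>\<sigma>\<close> acts on the \<open>l\<close>-th Fourier mode as
    multiplication by \<open>\<omega> ^ (l * \<sigma>)\<close>. Since \<open>?P\<close> has nonzero
    determinant, it can be cancelled.\<close>
  have "mdet (k * n) ?X * mdet (k * n) ?P = mdet (k * n) ?P * mdet (k * n) ?Y"
    unfolding mdet_mult
  proof (rule mdet_cong)
    fix a b assume ab: "a < k * n" "b < k * n"
    let ?i = "a mod n" and ?p = "a div n" and ?j = "b mod n" and ?l = "b div n"
    have "(\<Sum>c<k * n. B ?i ?p (c mod n) (c div n) * ?P c b) = (\<Sum>q<k. \<Sum>j<n. B ?i ?p j q * (if j = ?j then \<omega> ^ (q * ?l) else 0))"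
      by (rule sum_grid)
    also have "\<dots> = (\<Sum>q<k. B ?i ?p ?j q * \<omega> ^ (q * ?l))"
      using lt[OF ab(2)] by (simp add: if_distrib[of "\<lambda>x. _ * x"] cong: if_cong)
    also have "\<dots> = (\<Sum>q<k. if q = (?p + \<sigma> ?i ?j) mod k then (if adj ?i ?j then \<omega> ^ (q * ?l) else 0) else 0)"
      by (rule sum.cong) (auto simp: B_def)
    also have "\<dots> = (if adj ?i ?j then (\<omega> ^ ((?p + \<sigma> ?i ?j) mod k)) ^ ?l else 0)"
      using k by (simp add: power_mult)
    also have "\<omega> ^ ((?p + \<sigma> ?i ?j) mod k) = \<omega> ^ (?p + \<sigma> ?i ?j)" by (rule power_mod_root[OF root])
    finally have L: "(\<Sum>c<k * n. B ?i ?p (c mod n) (c div n) * ?P c b) = \<omega> ^ (?p * ?l) * A ?l ?i ?j"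
      by (simp add: A_def power_add power_mult_distrib power_mult[symmetric] mult.commute)
    have "(\<Sum>c<k * n. ?P a c * (if c div n = ?l then A (c div n) (c mod n) ?j else 0)) =
      (\<Sum>q<k. \<Sum>i<n. (if ?i = i then \<omega> ^ (?p * q) else 0) * (if q = ?l then A q i ?j else 0))"
      by (rule sum_grid)
    also have "\<dots> = (\<Sum>q<k. if q = ?l then \<omega> ^ (?p * ?l) * A ?l ?i ?j else 0)"
    proof (rule sum.cong[OF refl])
      fix q
      have "(\<Sum>i<n. (if ?i = i then \<omega> ^ (?p * q) else 0) * (if q = ?l then A q i ?j else 0))
        = (\<Sum>i<n. if ?i = i then (if q = ?l then \<omega> ^ (?p * ?l) * A ?l ?i ?j else 0) else 0)"
        by (rule sum.cong) auto
      then show "(\<Sum>i<n. (if ?i = i then \<omega> ^ (?p * q) else 0) * (if q = ?l then A q i ?j else 0))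
        = (if q = ?l then \<omega> ^ (?p * ?l) * A ?l ?i ?j else 0)" using lt[OF ab(1)] by simp
    qed
    also have "\<dots> = \<omega> ^ (?p * ?l) * A ?l ?i ?j" using lt[OF ab(2)] by simp
    finally have R: "(\<Sum>c<k * n. ?P a c * (if c div n = ?l then A (c div n) (c mod n) ?j else 0)) = \<omega> ^ (?p * ?l) * A ?l ?i ?j" .
    have "(\<Sum>c<k * n. ?X a c * ?P c b) = z * ?P a b - (\<Sum>c<k * n. B ?i ?p (c mod n) (c div n) * ?P c b)"
      by (simp only: left_diff_distrib sum_subtractf scalL[OF ab(1)])
    moreover have "(\<Sum>c<k * n. ?P a c * ?Y c b) = ?P a b * z - (\<Sum>c<k * n. ?P a c * (if c div n = ?l then A (c div n) (c mod n) ?j else 0))"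
      by (simp only: right_diff_distrib sum_subtractf scalR[OF ab(2)])
    ultimately show "(\<Sum>c<k * n. ?X a c * ?P c b) = (\<Sum>c<k * n. ?P a c * ?Y c b)"
      by (simp only: L R mult.commute[of z])
  qed
  then have "mdet (k * n) ?X = mdet (k * n) ?Y" using P0 by (simp add: mult.commute)
  also have "\<dots> = mdet (k * n) (\<lambda>a b. if a div n = b div n then
      (\<lambda>l i j. scal_mat z i j - A l i j) (a div n) (a mod n) (b mod n) else 0)"
  proof (rule mdet_cong)
    fix a b
    have "scal_mat z a b = (if a div n = b div n then scal_mat z (a mod n) (b mod n) else 0)"
      using eqi[of a b] by (simp add: scal_mat_def)
    then show "?Y a b = (if a div n = b div n then
      (\<lambda>l i j. scal_mat z i j - A l i j) (a div n) (a mod n) (b mod n) else 0)" by simp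
  qed
  also have "\<dots> = (\<Prod>l<k. mdet n (\<lambda>i j. scal_mat z i j - A l i j))" by (rule mdet_block_diag)
  finally show ?thesis by (simp only: B_def A_def)
qed

text \<open>Conjugation by the diagonal matrix of signs given by the two colours turns
  \<open>M\<close> into \<open>- M\<close> and keeps scalar matrices.\<close>

lemma mdet_bipartite_neg:
  assumes "\<And>a b. a < n \<Longrightarrow> b < n \<Longrightarrow> M a b \<noteq> 0 \<Longrightarrow> f a \<noteq> (f b :: bool)"
  shows "mdet n (\<lambda>a b. scal_mat (- z) a b - M a b) = (-1) ^ n * mdet n (\<lambda>a b. scal_mat z a b - M a b)"
proof -
  define \<epsilon> where "\<epsilon> a = (if f a then 1 else -1 :: complex)" for a
  have \<epsilon>2: "\<epsilon> a * \<epsilon> a = 1" for a by (simp add: \<epsilon>_def)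
  have entry: "scal_mat (- z) a b - M a b = - (\<epsilon> a * \<epsilon> b * (scal_mat z a b - M a b))" if "a < n" "b < n" for a b
    using assms[OF that] by (cases "a = b"; cases "M a b = 0") (auto simp: scal_mat_def \<epsilon>_def)
  show ?thesis unfolding mdet_perm sum_distrib_left
  proof (rule sum.cong[OF refl])
    fix p assume "p \<in> {p. p permutes {..<n}}"
    then have p: "p permutes {..<n}" by simp
    then have pn: "p i < n" if "i < n" for i using that permutes_in_image[OF p] by auto
    have "(\<Prod>i<n. scal_mat (- z) i (p i) - M i (p i)) = (\<Prod>i<n. (-1) * (\<epsilon> i * \<epsilon> (p i)) * (scal_mat z i (p i) - M i (p i)))"
      using entry pn by (intro prod.cong) auto
    also have "\<dots> = (-1) ^ n * ((\<Prod>i<n. \<epsilon> i) * (\<Prod>i<n. \<epsilon> (p i))) * (\<Prod>i<n. scal_mat z i (p i) - M i (p i))"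
      by (simp only: prod.distrib prod_constant card_lessThan)
    also have "(\<Prod>i<n. \<epsilon> (p i)) = (\<Prod>i<n. \<epsilon> i)" by (rule prod.permute[OF p, symmetric, unfolded o_def])
    also have "(\<Prod>i<n. \<epsilon> i) * (\<Prod>i<n. \<epsilon> i) = 1" by (simp add: prod.distrib[symmetric] \<epsilon>2)
    finally show "of_int (sign p) * (\<Prod>i<n. scal_mat (- z) i (p i) - M i (p i)) =
      (-1) ^ n * (of_int (sign p) * (\<Prod>i<n. scal_mat z i (p i) - M i (p i)))" by simp
  qed
qed

lemma poly_char_poly_adj_matrix:
  "complex_of_real (poly (char_poly (adj_matrix vs E)) x) =
     mdet (length vs) (\<lambda>a b. scal_mat (of_real x) a b - (if {vs ! a, vs ! b} \<in> E then 1 else 0))"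
proof -
  let ?A = "map_mat complex_of_real (adj_matrix vs E)"
  have A: "adj_matrix vs E \<in> carrier_mat (length vs) (length vs)" by (simp add: adj_matrix_def)
  have "complex_of_real (poly (char_poly (adj_matrix vs E)) x) = poly (char_poly ?A) (of_real x)"
    by (simp add: of_real_hom.char_poly_hom[OF A])
  also have "\<dots> = mdet (length vs) (\<lambda>a b. scal_mat (of_real x) a b - (if {vs ! a, vs ! b} \<in> E then 1 else 0))"
    unfolding char_poly_def mdet_def
    by (rule poly_det_cong[of _ "length vs"]) (auto simp: char_poly_matrix_def scal_mat_def adj_matrix_def)
  finally show ?thesis .
qed

text \<open>The shift seen from either endpoint. Against the orientation it is \<open>k - s\<close>
  instead of a negative number; for \<open>s = 0\<close> this is \<open>k\<close> itself, which is
  harmless because it is only used modulo \<open>k\<close>.\<close>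

definition lift_shift :: "('a \<Rightarrow> nat) \<Rightarrow> nat \<Rightarrow> ('a \<times> 'a \<Rightarrow> nat) \<Rightarrow> 'a \<Rightarrow> 'a \<Rightarrow> nat" where
  "lift_shift num k s u v = (if num u < num v then s (u, v) else k - s (v, u))"

lemma mod_shift_back:
  assumes "s < k" "p < k" "q < (k :: nat)"
  shows "p = (q + s) mod k \<longleftrightarrow> q = (p + (k - s)) mod k"
proof
  assume "p = (q + s) mod k"
  then have "(p + (k - s)) mod k = (q + s + (k - s)) mod k" by (simp add: mod_add_left_eq)
  then show "q = (p + (k - s)) mod k" using assms by simp
next
  assume "q = (p + (k - s)) mod k"
  then have "(q + s) mod k = (p + (k - s) + s) mod k" by (simp add: mod_add_left_eq)
  then show "p = (q + s) mod k" using assms by simp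
qed

text \<open>Removes the orientation from the description of the lift: an edge of \<open>E\<close>
  whose endpoints have different numbers is oriented in exactly one direction, and reading it
  backwards inverts the shift by \<open>mod_shift_back\<close>.\<close>

lemma lift_edges_iff:
  assumes s: "shift_function num k E s" and pq: "p < k" "q < k"
  shows "{(u, p), (v, q)} \<in> lift_edges num k E s \<longleftrightarrow>
     {u, v} \<in> E \<and> num u \<noteq> num v \<and> q = (p + lift_shift num k s u v) mod k"
proof
  assume "{(u, p), (v, q)} \<in> lift_edges num k E s"
  then obtain u' v' j where j: "(u', v') \<in> oriented_edges num E" "j < k"
    "{(u, p), (v, q)} = {(u', j), (v', (j + s (u', v')) mod k)}" by (auto simp: lift_edges_def)
  have sk: "s (u', v') < k" using s j by (auto simp: shift_function_def)
  have o: "{u', v'} \<in> E" "num u' < num v'" using j by (auto simp: oriented_edges_def)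
  from j(3) consider "u = u'" "v = v'" "p = j" "q = (j + s (u', v')) mod k"
    | "u = v'" "v = u'" "q = j" "p = (j + s (u', v')) mod k" by (auto simp: doubleton_eq_iff)
  then show "{u, v} \<in> E \<and> num u \<noteq> num v \<and> q = (p + lift_shift num k s u v) mod k"
  proof cases
    case 1
    then show ?thesis using o by (simp add: lift_shift_def)
  next
    case 2
    then show ?thesis using o mod_shift_back[OF sk pq] by (simp add: lift_shift_def insert_commute)
  qed
next
  assume a: "{u, v} \<in> E \<and> num u \<noteq> num v \<and> q = (p + lift_shift num k s u v) mod k"
  show "{(u, p), (v, q)} \<in> lift_edges num k E s"
  proof (cases "num u < num v")
    case True
    then have "(u, v) \<in> oriented_edges num E" using a by (simp add: oriented_edges_def)
    then show ?thesis using a True pq unfolding lift_edges_def lift_shift_def by auto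
  next
    case False
    then have o: "(v, u) \<in> oriented_edges num E" using a by (auto simp: oriented_edges_def insert_commute)
    then have "s (v, u) < k" using s by (auto simp: shift_function_def)
    then have "p = (q + s (v, u)) mod k"
      using a False mod_shift_back[of "s (v, u)" k p q] pq by (simp add: lift_shift_def)
    then have "{(u, p), (v, q)} = {(v, q), (u, (q + s (v, u)) mod k)}" by auto
    then show ?thesis using o pq unfolding lift_edges_def by auto
  qed
qed

lemma regular_lift:
  assumes E: "simple_graph V E" and reg: "regular_graph d V E" and inj: "inj_on num V"
    and s: "shift_function num k E s"
  shows "regular_graph d (lift_verts k V) (lift_edges num k E s)"
  unfolding regular_graph_def
proof
  fix w assume "w \<in> lift_verts k V"
  then obtain v j where w: "w = (v, j)" "v \<in> V" "j < k" by (auto simp: lift_verts_def)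
  let ?f = "\<lambda>u. (u, (j + lift_shift num k s v u) mod k)"
  \<comment> \<open>An edge whose endpoints had equal numbers would get no orientation and would be
    lost in the lift.\<close>
  have ne: "num u \<noteq> num v" if "{u, v} \<in> E" for u
  proof -
    from that E obtain a b where "a \<in> V" "b \<in> V" "a \<noteq> b" "{u, v} = {a, b}" unfolding simple_graph_def by meson
    then show ?thesis using inj by (auto simp: doubleton_eq_iff inj_on_def)
  qed
  have "{x \<in> lift_verts k V. {x, w} \<in> lift_edges num k E s} = ?f ` {u \<in> V. {u, v} \<in> E}"
  proof (intro equalityI subsetI)
    fix x assume x: "x \<in> {x \<in> lift_verts k V. {x, w} \<in> lift_edges num k E s}"
    then obtain u q where u: "x = (u, q)" "u \<in> V" "q < k" by (auto simp: lift_verts_def)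
    have "{(v, j), (u, q)} \<in> lift_edges num k E s" using x u w by (simp add: insert_commute)
    then have "{v, u} \<in> E" "q = (j + lift_shift num k s v u) mod k"
      using lift_edges_iff[OF s w(3) u(3), of v u] by auto
    moreover have "{v, u} = {u, v}" by auto
    ultimately show "x \<in> ?f ` {u \<in> V. {u, v} \<in> E}" using u by auto
  next
    fix x assume "x \<in> ?f ` {u \<in> V. {u, v} \<in> E}"
    then obtain u where u: "x = ?f u" "u \<in> V" "{u, v} \<in> E" by auto
    have "(j + lift_shift num k s v u) mod k < k" using w by simp
    from lift_edges_iff[OF s w(3) this, of v u] u ne[OF u(3)]
    have "{(v, j), ?f u} \<in> lift_edges num k E s" by (simp add: insert_commute)
    then show "x \<in> {x \<in> lift_verts k V. {x, w} \<in> lift_edges num k E s}"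
      using u w by (simp add: lift_verts_def insert_commute)
  qed
  moreover have "card (?f ` {u \<in> V. {u, v} \<in> E}) = card {u \<in> V. {u, v} \<in> E}"
    by (rule card_image) (auto simp: inj_on_def)
  ultimately show "card {x \<in> lift_verts k V. {x, w} \<in> lift_edges num k E s} = d"
    using reg w by (simp add: regular_graph_def)
qed

lemma bipartite_lift:
  assumes "bipartite_graph V E" "k > 0"
  shows "bipartite_graph (lift_verts k V) (lift_edges num k E s)"
proof -
  from assms obtain X Y where XY: "X \<union> Y = V" "X \<inter> Y = {}" "\<forall>e\<in>E. \<exists>x\<in>X. \<exists>y\<in>Y. e = {x, y}"
    unfolding bipartite_graph_def by (elim conjE exE) blast
  have "\<exists>x\<in>X \<times> {0..<k}. \<exists>y\<in>Y \<times> {0..<k}. e = {x, y}" if "e \<in> lift_edges num k E s" for e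
  proof -
    from that obtain u v j where e: "e = {(u, j), (v, (j + s (u, v)) mod k)}" "{u, v} \<in> E" "j < k"
      by (auto simp: lift_edges_def oriented_edges_def)
    from bspec[OF XY(3) e(2)] obtain x y where xy: "x \<in> X" "y \<in> Y" "{u, v} = {x, y}" by blast
    have l: "(j + s (u, v)) mod k < k" using assms by simp
    from xy(3) consider "u = x" "v = y" | "u = y" "v = x" by (auto simp: doubleton_eq_iff)
    then show ?thesis
    proof cases
      case 1
      then have "(u, j) \<in> X \<times> {0..<k}" "(v, (j + s (u, v)) mod k) \<in> Y \<times> {0..<k}" using xy e(3) l by auto
      then show ?thesis using e(1) by metis
    next
      case 2
      then have "(v, (j + s (u, v)) mod k) \<in> X \<times> {0..<k}" "(u, j) \<in> Y \<times> {0..<k}" using xy e(3) l by auto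
      moreover have "e = {(v, (j + s (u, v)) mod k), (u, j)}" using e(1) by auto
      ultimately show ?thesis by metis
    qed
  qed
  moreover have "X \<times> {0..<k} \<union> Y \<times> {0..<k} = lift_verts k V" "X \<times> {0..<k} \<inter> Y \<times> {0..<k} = {}"
    using XY by (auto simp: lift_verts_def)
  ultimately show ?thesis unfolding bipartite_graph_def by blast
qed

section \<open>From bounded twisted matrices to Ramanujan lifts\<close>

locale numbered_graph =
  fixes V :: "'a set" and E :: "'a set set" and d :: nat and num :: "'a \<Rightarrow> nat"
  assumes d: "d \<ge> 2" and simple: "simple_graph V E" and regular: "regular_graph d V E"
    and bipartite: "bipartite_graph V E" and num: "bij_betw num V {1..card V}"
begin

abbreviation "n \<equiv> card V"

text \<open>\<open>num\<close> counts from 1 and matrix indices from 0. The order is preserved, so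
  \<open>i < j\<close> agrees with the orientation of edges.\<close>

definition vtx :: "nat \<Rightarrow> 'a" where "vtx i = inv_into V num (Suc i)"

definition adj :: "nat \<Rightarrow> nat \<Rightarrow> bool" where
  "adj i j \<longleftrightarrow> i < n \<and> j < n \<and> {vtx i, vtx j} \<in> E"

lemma vtx_in: "i < n \<Longrightarrow> vtx i \<in> V" and num_vtx: "i < n \<Longrightarrow> num (vtx i) = Suc i"
proof -
  assume "i < n"
  then have "Suc i \<in> num ` V" using num by (auto simp: bij_betw_def)
  then show "vtx i \<in> V" "num (vtx i) = Suc i" unfolding vtx_def by (auto intro: inv_into_into f_inv_into_f)
qed

lemma num_inj: "inj_on num V" using num by (simp add: bij_betw_def)

lemma vtx_num: "v \<in> V \<Longrightarrow> num v - 1 < n \<and> vtx (num v - 1) = v"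
proof -
  assume v: "v \<in> V"
  then have "num v \<in> {1..n}" using num by (auto simp: bij_betw_def)
  then show ?thesis using v num_inj by (auto simp: vtx_def)
qed

lemma bij_vtx: "bij_betw vtx {..<n} V"
  by (rule bij_betw_byWitness[where f' = "\<lambda>v. num v - 1"]) (auto simp: vtx_in num_vtx vtx_num[simplified])

lemma edge_verts: "{u, v} \<in> E \<Longrightarrow> u \<in> V \<and> v \<in> V \<and> u \<noteq> v"
proof -
  assume "{u, v} \<in> E"
  with simple obtain a b where "a \<in> V" "b \<in> V" "a \<noteq> b" "{u, v} = {a, b}" unfolding simple_graph_def by meson
  then show ?thesis by (auto simp: doubleton_eq_iff)
qed

lemma adj_sym: "adj i j \<Longrightarrow> adj j i" by (simp add: adj_def insert_commute)

lemma adj_irrefl: "\<not> adj i i" using edge_verts[of "vtx i" "vtx i"] by (auto simp: adj_def)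

lemma adj_deg: "i < n \<Longrightarrow> card {j. j < n \<and> adj i j} = d"
proof -
  assume i: "i < n"
  have "vtx ` {j. j < n \<and> adj i j} = {u \<in> V. {u, vtx i} \<in> E}"
  proof (intro equalityI subsetI)
    fix u assume u: "u \<in> {u \<in> V. {u, vtx i} \<in> E}"
    then have "u = vtx (num u - 1)" "num u - 1 < n" using vtx_num[of u] by auto
    then show "u \<in> vtx ` {j. j < n \<and> adj i j}" using u i
      by (intro image_eqI[of _ _ "num u - 1"]) (auto simp: adj_def insert_commute)
  qed (auto simp: adj_def vtx_in insert_commute)
  moreover have "inj_on vtx {j. j < n \<and> adj i j}"
    using bij_vtx by (auto simp: bij_betw_def intro: inj_on_subset)
  ultimately have "card {j. j < n \<and> adj i j} = card {u \<in> V. {u, vtx i} \<in> E}"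
    using card_image[of vtx "{j. j < n \<and> adj i j}"] by simp
  then show ?thesis using regular vtx_in[OF i] by (simp add: regular_graph_def)
qed

text \<open>The eigenvalues of a Hermitian matrix are real, so for such \<open>M\<close> testing
  real \<open>x\<close> bounds the whole spectrum.\<close>

definition spectrally_bounded :: "(nat \<Rightarrow> nat \<Rightarrow> complex) \<Rightarrow> bool" where
  "spectrally_bounded M \<longleftrightarrow>
     (\<forall>x::real. \<bar>x\<bar> > 2 * sqrt (real d - 1) \<longrightarrow> mdet n (\<lambda>i j. scal_mat (of_real x) i j - M i j) \<noteq> 0)"

lemma exists_spectrally_bounded:
  assumes "k > 0" "\<zeta> ^ k = 1" "\<zeta> \<noteq> 1" "\<And>e. cmod (c e) = 1"
  shows "\<exists>t. (\<forall>e. t e < k) \<and> spectrally_bounded (\<lambda>a b. if \<not> adj a b then 0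
     else if a < b then c (a, b) * \<zeta> ^ t (a, b) else cnj (c (b, a) * \<zeta> ^ t (b, a)))"
proof -
  interpret regular_choices n k \<zeta> c adj d
    by unfold_locales (use assms adj_sym adj_irrefl adj_deg d in auto)
  obtain t where t: "\<And>e. t e < k"
    "\<And>x. x > 2 * sqrt (real d - 1) \<Longrightarrow> Re (mdet n (\<lambda>a b. scal_mat (of_real x) a b - hmat t a b)) > 0"
    using exists_good_choice by blast
  obtain X Y where XY: "X \<inter> Y = {}" "\<forall>e\<in>E. \<exists>x\<in>X. \<exists>y\<in>Y. e = {x, y}"
    using bipartite unfolding bipartite_graph_def by (elim conjE exE) blast
  have col: "(vtx a \<in> X) \<noteq> (vtx b \<in> X)" if "hmat t a b \<noteq> 0" for a b
  proof -
    have "{vtx a, vtx b} \<in> E" using that by (auto simp: hmat_def adj_def split: if_splits)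
    from bspec[OF XY(2) this] XY(1) show ?thesis by (auto simp: doubleton_eq_iff)
  qed
  have "spectrally_bounded (hmat t)"
    unfolding spectrally_bounded_def
  proof (intro allI impI)
    fix x :: real assume x: "\<bar>x\<bar> > 2 * sqrt (real d - 1)"
    show "mdet n (\<lambda>i j. scal_mat (of_real x) i j - hmat t i j) \<noteq> 0"
    proof (cases "x > 0")
      case True
      then show ?thesis using t(2)[of x] x by auto
    next
      case False
      then have "Re (mdet n (\<lambda>i j. scal_mat (of_real (- x)) i j - hmat t i j)) > 0" using t(2)[of "- x"] x by auto
      moreover have "mdet n (\<lambda>i j. scal_mat (- of_real (- x)) i j - hmat t i j) = (-1) ^ n * mdet n (\<lambda>i j. scal_mat (of_real (- x)) i j - hmat t i j)"
        by (rule mdet_bipartite_neg[where f = "\<lambda>a. vtx a \<in> X"]) (rule col)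
      ultimately show ?thesis by auto
    qed
  qed
  then show ?thesis using t(1) unfolding hmat_def wt_def by blast
qed

definition twisted_adj :: "complex \<Rightarrow> (nat \<times> nat \<Rightarrow> nat) \<Rightarrow> nat \<Rightarrow> nat \<Rightarrow> complex" where
  "twisted_adj \<eta> t a b = (if \<not> adj a b then 0 else if a < b then \<eta> ^ t (a, b) else cnj (\<eta> ^ t (b, a)))"

text \<open>Conjugating all entries conjugates the determinant at real \<open>x\<close>, so the same
  shifts serve both characters of a conjugate pair.\<close>

lemma spectrally_bounded_cnj:
  assumes "spectrally_bounded (twisted_adj \<eta> t)"
  shows "spectrally_bounded (twisted_adj (cnj \<eta>) t)"
proof -
  have "mdet n (\<lambda>i j. scal_mat (of_real x) i j - twisted_adj (cnj \<eta>) t i j)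
      = cnj (mdet n (\<lambda>i j. scal_mat (of_real x) i j - twisted_adj \<eta> t i j))" for x
    unfolding mdet_cnj[symmetric] by (rule mdet_cong) (auto simp: scal_mat_def twisted_adj_def)
  then show ?thesis using assms by (simp add: spectrally_bounded_def)
qed

lemma hermitian_twisted_adj: "hermitian (twisted_adj \<eta> t)"
  unfolding hermitian_def
proof (intro allI)
  fix a b
  show "cnj (twisted_adj \<eta> t a b) = twisted_adj \<eta> t b a"
    using adj_sym[of a b] adj_sym[of b a] adj_irrefl[of a]
    by (cases a b rule: linorder_cases) (auto simp: twisted_adj_def)
qed

text \<open>The spectrum of the lift is a multiset of real roots, so the complex factor of each
  character has to be replaced by a real polynomial; this works since Hermitian determinants are
  real at real points.\<close>

lemma real_poly_twisted_adj:
  "\<exists>r. r \<noteq> 0 \<and> (\<forall>x. complex_of_real (poly r x) = mdet n (\<lambda>i j. scal_mat (of_real x) i j - twisted_adj \<eta> t i j))"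
proof -
  have h: "hermitian (\<lambda>i j. - twisted_adj \<eta> t i j)" using hermitian_twisted_adj by (simp add: hermitian_def)
  obtain p where p: "degree p = n" "lead_coeff p = 1"
    "\<And>z. mdet n (\<lambda>i j. scal_mat z i j + - twisted_adj \<eta> t i j) = poly p z"
    using mdet_poly[of n "\<lambda>i j. - twisted_adj \<eta> t i j"] by blast
  have "Im (poly p (of_real x)) = 0" for x
    using mdet_hermitian_real[OF hermitian_scal_add[OF h, of x], of n] p(3) by simp
  then have "complex_of_real (poly (map_poly Re p) x) = mdet n (\<lambda>i j. scal_mat (of_real x) i j - twisted_adj \<eta> t i j)" for x
    using p(3)[of "of_real x"] by (simp add: poly_map_Re complex_eq_iff)
  moreover have "map_poly Re p \<noteq> 0"
  proof
    assume "map_poly Re p = 0"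
    then have "coeff (map_poly Re p) n = 0" by simp
    then show False using p by (simp add: coeff_map_poly)
  qed
  ultimately show ?thesis by blast
qed

text \<open>The trivial character contributes the characteristic polynomial of the base graph, whose
  spectrum obeys the bound after the trivial eigenvalues are removed. The other characters
  contribute the new eigenvalues, and \<open>bounded\<close> covers all of these.\<close>

lemma exists_ramanujan_lift:
  assumes ram: "ramanujan_graph d V E"
    and k: "k > 0" and root: "\<omega> ^ k = 1" and prim: "\<And>m. 0 < m \<Longrightarrow> m < k \<Longrightarrow> \<omega> ^ m \<noteq> 1"
    and t: "\<And>e. t e < k" and bounded: "\<And>l. 0 < l \<Longrightarrow> l < k \<Longrightarrow> spectrally_bounded (twisted_adj (\<omega> ^ l) t)"
  shows "\<exists>s. shift_function num k E s \<and>
            regular_graph d (lift_verts k V) (lift_edges num k E s) \<and>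
            bipartite_graph (lift_verts k V) (lift_edges num k E s) \<and>
            ramanujan_graph d (lift_verts k V) (lift_edges num k E s)"
proof -
  define s where "s = (\<lambda>(u, v). t (num u - 1, num v - 1))"
  have s: "shift_function num k E s" using t by (simp add: shift_function_def s_def split_beta)
  let ?F = "lift_edges num k E s"
  define \<sigma> where "\<sigma> i j = lift_shift num k s (vtx i) (vtx j)" for i j
  have norm\<omega>: "cmod \<omega> = 1" by (rule norm_root_of_unity[OF k root])
  have tw: "twisted_adj (\<omega> ^ l) t i j = (if adj i j then \<omega> ^ (l * \<sigma> i j) else 0)" for l i j
  proof (cases "adj i j")
    case True
    then have ij: "i < n" "j < n" "i \<noteq> j" using adj_irrefl by (auto simp: adj_def)
    show ?thesis
    proof (cases "i < j")
      case True
      then show ?thesis using ij \<open>adj i j\<close>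
        by (simp add: twisted_adj_def \<sigma>_def lift_shift_def num_vtx s_def power_mult)
    next
      case False
      \<comment> \<open>Below the diagonal the entry is a conjugate, while the lift uses the
        reversed shift \<open>k - m\<close>; the two agree because \<open>\<eta>\<close> is a
        \<open>k\<close>-th root of unity.\<close>
      define \<eta> where "\<eta> = \<omega> ^ l"
      define m where "m = t (j, i)"
      have "m \<le> k" using t[of "(j, i)"] by (simp add: m_def)
      have "\<eta> ^ k = (\<omega> ^ k) ^ l" by (simp add: \<eta>_def power_mult[symmetric] mult.commute)
      then have "\<eta> ^ k = 1" using root by simp
      then have "\<eta> ^ m * \<eta> ^ (k - m) = 1" using \<open>m \<le> k\<close> by (simp add: power_add[symmetric])
      moreover have "cnj (\<eta> ^ m) * \<eta> ^ m = 1"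
      proof -
        have "cmod (\<eta> ^ m) = 1" using norm\<omega> by (simp add: \<eta>_def norm_power)
        from mult_cnj_unit[OF this] show ?thesis by (simp add: mult.commute)
      qed
      ultimately have "cnj (\<eta> ^ m) = \<eta> ^ (k - m)" by (metis mult.assoc mult.commute mult_1)
      then show ?thesis using ij False \<open>adj i j\<close>
        by (simp add: twisted_adj_def \<sigma>_def lift_shift_def num_vtx s_def power_mult \<eta>_def m_def)
    qed
  qed (simp add: twisted_adj_def)
  define vs where "vs = map vtx [0..<n]"
  have vs: "distinct vs" "set vs = V" "length vs = n" "\<And>i. i < n \<Longrightarrow> vs ! i = vtx i"
    using bij_vtx by (auto simp: vs_def distinct_map bij_betw_def lessThan_atLeast0)
  define ws where "ws = map (\<lambda>a. (vtx (a mod n), a div n)) [0..<k * n]"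
  have lt: "a div n < k" "a mod n < n" if "a < k * n" for a
    using that by (auto simp: less_mult_imp_div_less intro!: mod_less_divisor gr0I)
  have ws: "distinct ws" "set ws = lift_verts k V" "length ws = k * n"
    "\<And>a. a < k * n \<Longrightarrow> ws ! a = (vtx (a mod n), a div n)"
  proof -
    have "inj_on (\<lambda>a. (vtx (a mod n), a div n)) {0..<k * n}"
    proof (rule inj_onI)
      fix a b assume ab: "a \<in> {0..<k * n}" "b \<in> {0..<k * n}" "(vtx (a mod n), a div n) = (vtx (b mod n), b div n)"
      then have "a mod n = b mod n" using lt[of a] lt[of b] bij_vtx by (auto simp: bij_betw_def inj_on_def)
      then show "a = b" using ab by (metis div_mult_mod_eq prod.inject)
    qed
    then show "distinct ws" by (simp add: ws_def distinct_map)
    show "set ws = lift_verts k V"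
    proof (intro equalityI subsetI)
      fix x assume "x \<in> set ws"
      then show "x \<in> lift_verts k V" using lt vtx_in by (auto simp: ws_def lift_verts_def)
    next
      fix x assume "x \<in> lift_verts k V"
      then obtain v p where x: "x = (v, p)" "v \<in> V" "p < k" by (auto simp: lift_verts_def)
      define i where "i = num v - 1"
      have i: "i < n" "vtx i = v" using vtx_num[OF x(2)] by (auto simp: i_def)
      have "p * n + i < p * n + n" using i by simp
      also have "\<dots> = Suc p * n" by simp
      also have "\<dots> \<le> k * n" using x by (intro mult_le_mono1) simp
      finally have "p * n + i < k * n" .
      moreover have "(p * n + i) mod n = i" "(p * n + i) div n = p" using i by auto
      ultimately show "x \<in> set ws" using x i unfolding ws_def by (auto intro!: image_eqI[of _ _ "p * n + i"])
    qed
  qed (auto simp: ws_def)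
  have H: "complex_of_real (poly (char_poly (adj_matrix ws ?F)) x) =
    (\<Prod>l<k. mdet n (\<lambda>i j. scal_mat (of_real x) i j - twisted_adj (\<omega> ^ l) t i j))" for x
  proof -
    have "complex_of_real (poly (char_poly (adj_matrix ws ?F)) x) =
      mdet (k * n) (\<lambda>a b. scal_mat (of_real x) a b - (if {ws ! a, ws ! b} \<in> ?F then 1 else 0))"
      unfolding poly_char_poly_adj_matrix ws(3) ..
    also have "\<dots> = mdet (k * n) (\<lambda>a b. scal_mat (of_real x) a b -
       (if adj (a mod n) (b mod n) \<and> b div n = (a div n + \<sigma> (a mod n) (b mod n)) mod k then 1 else 0))"
    proof (rule mdet_cong)
      fix a b assume ab: "a < k * n" "b < k * n"
      have "{ws ! a, ws ! b} \<in> ?F \<longleftrightarrow> {vtx (a mod n), vtx (b mod n)} \<in> E \<and> num (vtx (a mod n)) \<noteq> num (vtx (b mod n))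
        \<and> b div n = (a div n + \<sigma> (a mod n) (b mod n)) mod k"
        unfolding ws(4)[OF ab(1)] ws(4)[OF ab(2)] \<sigma>_def by (rule lift_edges_iff[OF s lt(1)[OF ab(1)] lt(1)[OF ab(2)]])
      also have "\<dots> \<longleftrightarrow> adj (a mod n) (b mod n) \<and> b div n = (a div n + \<sigma> (a mod n) (b mod n)) mod k"
        using lt[OF ab(1)] lt[OF ab(2)] adj_irrefl[of "a mod n"] by (auto simp: adj_def num_vtx)
      finally show "scal_mat (of_real x) a b - (if {ws ! a, ws ! b} \<in> ?F then 1 else 0) = scal_mat (of_real x) a b -
       (if adj (a mod n) (b mod n) \<and> b div n = (a div n + \<sigma> (a mod n) (b mod n)) mod k then 1 else 0 :: complex)" by simp
    qed
    also have "\<dots> = (\<Prod>l<k. mdet n (\<lambda>i j. scal_mat (of_real x) i j - twisted_adj (\<omega> ^ l) t i j))"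
      unfolding tw by (rule mdet_shift_lift[OF k root prim])
    finally show ?thesis .
  qed
  have G: "complex_of_real (poly (char_poly (adj_matrix vs E)) x) =
    mdet n (\<lambda>i j. scal_mat (of_real x) i j - twisted_adj (\<omega> ^ 0) t i j)" for x
    unfolding poly_char_poly_adj_matrix vs(3)
    by (rule mdet_cong) (auto simp: twisted_adj_def adj_def vs)
  have "\<forall>l. \<exists>r. r \<noteq> 0 \<and> (\<forall>x. complex_of_real (poly r x) = mdet n (\<lambda>i j. scal_mat (of_real x) i j - twisted_adj (\<omega> ^ l) t i j))"
    by (intro allI real_poly_twisted_adj)
  then obtain r where r: "\<And>l. r l \<noteq> 0"
    "\<And>l x. complex_of_real (poly (r l) x) = mdet n (\<lambda>i j. scal_mat (of_real x) i j - twisted_adj (\<omega> ^ l) t i j)" by metis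
  have split: "{..<k} = insert 0 {0<..<k}" using k by auto
  \<comment> \<open>Both sides are real polynomials, so agreement of their complex values at all
    real points identifies them.\<close>
  have "poly (char_poly (adj_matrix ws ?F)) x = poly (char_poly (adj_matrix vs E) * (\<Prod>l\<in>{0<..<k}. r l)) x" for x
  proof -
    have "complex_of_real (poly (char_poly (adj_matrix ws ?F)) x) = complex_of_real (poly (char_poly (adj_matrix vs E) * (\<Prod>l\<in>{0<..<k}. r l)) x)"
      unfolding H split by (simp add: G r(2) poly_prod)
    then show ?thesis by (simp only: of_real_eq_iff)
  qed
  then have cp: "char_poly (adj_matrix ws ?F) = char_poly (adj_matrix vs E) * (\<Prod>l\<in>{0<..<k}. r l)"
    by (simp only: poly_eq_poly_eq_iff[symmetric]) blast
  have "char_poly (adj_matrix vs E) \<noteq> 0"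
    using degree_monic_char_poly[of "adj_matrix vs E" n] by (auto simp: adj_matrix_def vs)
  then have spec: "graph_spectrum (lift_verts k V) ?F = graph_spectrum V E + proots (\<Prod>l\<in>{0<..<k}. r l)"
    unfolding graph_spectrum_eq[OF ws(1,2)] graph_spectrum_eq[OF vs(1,2)] cp
    using r(1) by (intro proots_mult) auto
  have "ramanujan_graph d (lift_verts k V) ?F"
    unfolding ramanujan_graph_def
  proof
    fix \<mu> assume "\<mu> \<in># graph_spectrum (lift_verts k V) ?F - {# real d, - real d #}"
    \<comment> \<open>The trivial eigenvalues are to be taken from the old part. Only an inclusion
      holds: if the old part lacks an element of \<open>C\<close>, the left side may lose a copy
      from \<open>B\<close> instead.\<close>
    moreover have "A + B - C \<subseteq># (A - C) + B" for A B C :: "real multiset"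
      by (auto simp: subseteq_mset_def)
    ultimately have "\<mu> \<in># (graph_spectrum V E - {# real d, - real d #}) + proots (\<Prod>l\<in>{0<..<k}. r l)"
      unfolding spec by (metis mset_subset_eqD)
    then consider "\<mu> \<in># graph_spectrum V E - {# real d, - real d #}" | "\<mu> \<in># proots (\<Prod>l\<in>{0<..<k}. r l)" by auto
    then show "\<bar>\<mu>\<bar> \<le> 2 * sqrt (real d - 1)"
    proof cases
      case 1
      then show ?thesis using ram by (simp add: ramanujan_graph_def)
    next
      case 2
      then have "poly (\<Prod>l\<in>{0<..<k}. r l) \<mu> = 0" using r(1) by simp
      then obtain l where l: "0 < l" "l < k" "poly (r l) \<mu> = 0" by (auto simp: poly_prod)
      then have "mdet n (\<lambda>i j. scal_mat (of_real \<mu>) i j - twisted_adj (\<omega> ^ l) t i j) = 0" using r(2)[of l \<mu>] by simp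
      then show ?thesis using bounded[OF l(1,2)] by (auto simp: spectrally_bounded_def not_less)
    qed
  qed
  then show ?thesis
    using s regular_lift[OF simple regular num_inj s] bipartite_lift[OF bipartite k] by blast
qed

end

section \<open>Shifts modulo 3 and modulo 4\<close>

theorem theorem1:
  fixes V :: "'a set" and E :: "'a set set" and d :: nat and num :: "'a \<Rightarrow> nat"
  assumes "d \<ge> 2"
    and "simple_graph V E"
    and "regular_graph d V E"
    and "bipartite_graph V E"
    and "ramanujan_graph d V E"
    and "bij_betw num V {1..card V}"
  shows "(\<exists>s. shift_function num 3 E s \<and>
            regular_graph d (lift_verts 3 V) (lift_edges num 3 E s) \<and>
            bipartite_graph (lift_verts 3 V) (lift_edges num 3 E s) \<and>
            ramanujan_graph d (lift_verts 3 V) (lift_edges num 3 E s)) \<and>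
         (\<exists>s. shift_function num 4 E s \<and>
            regular_graph d (lift_verts 4 V) (lift_edges num 4 E s) \<and>
            bipartite_graph (lift_verts 4 V) (lift_edges num 4 E s) \<and>
            ramanujan_graph d (lift_verts 4 V) (lift_edges num 4 E s))"
proof
  interpret numbered_graph V E d num using assms by unfold_locales
  \<comment> \<open>The primitive cube root of unity in the upper half-plane; its square is its
    conjugate, so one bounded twisted matrix settles both nontrivial characters.\<close>
  define \<omega> where "\<omega> = Complex (-1/2) (sqrt 3 / 2)"
  have w2: "\<omega> ^ 2 = cnj \<omega>" by (simp add: \<omega>_def power2_eq_square complex_eq_iff)
  have w1: "\<omega> \<noteq> 1" "cnj \<omega> \<noteq> 1" by (auto simp: \<omega>_def complex_eq_iff)
  have w3: "\<omega> ^ 3 = 1"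
    by (simp add: \<omega>_def power3_eq_cube complex_eq_iff)
  have less3: "m = 1 \<or> m = 2" if "0 < m" "m < 3" for m :: nat using that by auto
  obtain t where t: "\<And>e. t e < 3" "spectrally_bounded (\<lambda>a b. if \<not> adj a b then 0
     else if a < b then 1 * \<omega> ^ t (a, b) else cnj (1 * \<omega> ^ t (b, a)))"
    using exists_spectrally_bounded[of 3 \<omega> "\<lambda>_. 1"] w1 w3 by auto
  have b1: "spectrally_bounded (twisted_adj \<omega> t)" using t(2) unfolding twisted_adj_def mult_1 .
  show "\<exists>s. shift_function num 3 E s \<and>
            regular_graph d (lift_verts 3 V) (lift_edges num 3 E s) \<and>
            bipartite_graph (lift_verts 3 V) (lift_edges num 3 E s) \<and>
            ramanujan_graph d (lift_verts 3 V) (lift_edges num 3 E s)"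
  proof (rule exists_ramanujan_lift[OF assms(5) _ w3])
    show "\<omega> ^ m \<noteq> 1" if "0 < m" "m < 3" for m using less3[OF that] w1 w2 by auto
    show "spectrally_bounded (twisted_adj (\<omega> ^ l) t)" if "0 < l" "l < 3" for l
      using less3[OF that] b1 spectrally_bounded_cnj[OF b1] w2 by auto
  qed (use t in auto)
next
  interpret numbered_graph V E d num using assms by unfold_locales
  obtain t where t: "\<And>e. t e < 2" "spectrally_bounded (\<lambda>a b. if \<not> adj a b then 0
     else if a < b then 1 * (-1) ^ t (a, b) else cnj (1 * (-1) ^ t (b, a)))"
    using exists_spectrally_bounded[of 2 "-1" "\<lambda>_. 1"] by auto
  \<comment> \<open>Once \<open>t\<close> is fixed, the upper bit of a shift multiplies
    \<open>\<i> ^ t e\<close> by a free sign. These two candidates have mean zero, so the existence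
    result applies again with \<open>\<i> ^ t e\<close> as the fixed factor.\<close>
  obtain t' where t': "\<And>e. t' e < 2" "spectrally_bounded (\<lambda>a b. if \<not> adj a b then 0
     else if a < b then \<i> ^ t (a, b) * (-1) ^ t' (a, b) else cnj (\<i> ^ t (b, a) * (-1) ^ t' (b, a)))"
    using exists_spectrally_bounded[of 2 "-1" "\<lambda>e. \<i> ^ t e"] by (auto simp: norm_power)
  \<comment> \<open>The signs \<open>(-1)\<^bsup>T e\<^esup>\<close> depend on \<open>t\<close> only, so \<open>t\<close> and \<open>t'\<close> can be chosen one after the other.\<close>
  define T where "T e = t e + 2 * t' e" for e
  have iT: "\<i> ^ T e = \<i> ^ t e * (-1) ^ t' e" for e by (simp add: T_def power_add power_mult)
  have mT: "(-1) ^ T e = (-1 :: complex) ^ t e" for e by (simp add: T_def power_add power_mult)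
  have b1: "spectrally_bounded (twisted_adj \<i> T)" using t'(2) unfolding twisted_adj_def iT .
  have b2: "spectrally_bounded (twisted_adj (-1) T)" using t(2) unfolding twisted_adj_def mT mult_1 .
  have b3: "spectrally_bounded (twisted_adj (- \<i>) T)" using spectrally_bounded_cnj[OF b1] by simp
  have less4: "m = 1 \<or> m = 2 \<or> m = 3" if "0 < m" "m < 4" for m :: nat using that by auto
  show "\<exists>s. shift_function num 4 E s \<and>
            regular_graph d (lift_verts 4 V) (lift_edges num 4 E s) \<and>
            bipartite_graph (lift_verts 4 V) (lift_edges num 4 E s) \<and>
            ramanujan_graph d (lift_verts 4 V) (lift_edges num 4 E s)"
  proof (rule exists_ramanujan_lift[OF assms(5)])
    show "\<i> ^ 4 = 1" by simp
    show "\<i> ^ m \<noteq> 1" if "0 < m" "m < 4" for m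
      using less4[OF that] by (auto simp: power3_eq_cube complex_eq_iff)
    show "spectrally_bounded (twisted_adj (\<i> ^ l) T)" if "0 < l" "l < 4" for l
      using less4[OF that] b1 b2 b3 by (auto simp: power3_eq_cube)
    show "T e < 4" for e using t(1)[of e] t'(1)[of e] by (simp add: T_def)
  qed simp
qed

end
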